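(* Let $\mathcal{P}=(P_0\ltimes P_1,\{\,,\,\})$ be an admissible Poisson algebra over the Poisson algebra $\mathcal{P}_0$. If the Lie algebra $(P_1,[\,,\,]_1)$ associated to $\mathcal{P}$ is perfect and centerless, and the first Poisson cohomology of $\mathcal{P}_0$ is trivial, then there is an isomorphism of $R$-modules $$\mathscr{H}^1(\mathcal{P})\simeq\frac{\mathfrak{M}_0(\mathcal{P})}{\mathscr{C}_0(\mathcal{P})+\mathrm{Inn}(P_1,[\,,\,]_1)}.$$
   Context: Let $R$ be a commutative ring with unit, $\mathcal{P}_0=(P_0,\cdot,\{\,,\,\}_0)$ a Poisson $R$-algebra (commutative associative unital $R$-algebra with an $R$-bilinear Lie bracket that is a derivation in each argument), $P_1$ a faithful $P_0$-module, and $P=P_0\ltimes P_1$ the $R$-module $P_0\oplus P_1$ with product $(f\oplus\eta)(g\oplus\xi)=fg\oplus(f\xi+g\eta)$. An admissible Poisson structure on $P$ is a Poisson structure with $\mathrm{pr}_0\{f\oplus\eta,g\oplus\xi\}=\{f,g\}_0$; $\mathcal{P}=(P,\{\,,\,\})$ is then an admissible Poisson algebra. $\Omega^1_{P_0}$ is the module of Kähler differentials of $P_0$ over $R$ with universal derivation $d$, anchor $\varrho_{P_0}(dh)=\{h,\cdot\}_0$ (extended $P_0$-linearly). A contravariant derivative on $P_1$ is an $R$-bilinear map $\mathcal{D}:\Omega^1_{P_0}\times P_1\to P_1$ with $\mathcal{D}_{f\alpha}\eta=f\mathcal{D}_\alpha\eta$, $\mathcal{D}_\alpha(f\eta)=f\mathcal{D}_\alpha\eta+\varrho_{P_0}(\alpha)(f)\eta$.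 Every admissible Poisson algebra has a unique corresponding Poisson triple $([\,,\,]_1,\mathcal{D},\mathcal{K})$, where $[\,,\,]_1$ is a $P_0$-linear Lie bracket on $P_1$ (giving the associated Lie algebra $(P_1,[\,,\,]_1)$), $\mathcal{D}$ a contravariant derivative on $P_1$, and $\mathcal{K}:\Omega^1_{P_0}\times\Omega^1_{P_0}\to P_1$ a $P_0$-bilinear skew-symmetric map, such that $\{f\oplus\eta,g\oplus\xi\}=\{f,g\}_0\oplus(\mathcal{D}_{df}\xi-\mathcal{D}_{dg}\eta+[\eta,\xi]_1+\mathcal{K}(df,dg))$. Perfect: $P_1=[P_1,P_1]_1$. Centerless: $[\xi,\cdot]_1=0$ implies $\xi=0$. The first Poisson cohomology of a Poisson algebra $\mathcal{Q}$ is $\mathscr{H}^1(\mathcal{Q})=\mathrm{Poiss}(\mathcal{Q})/\mathrm{Ham}(\mathcal{Q})$, with $\mathrm{Poiss}(\mathcal{Q})$ the derivations of the commutative algebra that are also derivations of the bracket and $\mathrm{Ham}(\mathcal{Q})$ the derivations $\{q,\cdot\}$. $\mathrm{Casim}(\mathcal{P}_0)=\{k\in P_0\mid\{k,\cdot\}_0=0\}$. Write $\mathrm{ad}_\eta=[\eta,\cdot]_1$ and let $\boldsymbol{[}\cdot,\cdot\boldsymbol{]}$ denote the commutator of $R$-linear maps. $\mathrm{Der}(P_0;P_1)$ is the module of $R$-linear $D:P_0\to P_1$ with $D(fg)=fDg+gDf$, and $(d_{\mathcal{D}}\theta)(f,g)=\mathcal{D}_{df}\theta(g)-\mathcal{D}_{dg}\theta(f)-\theta(\{f,g\}_0)$.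 $\mathfrak{M}_0(\mathcal{P})$ is the set of $P_0$-linear maps $\mathscr{L}':P_1\to P_1$ with $\mathscr{L}'[\eta,\xi]_1=[\mathscr{L}'\eta,\xi]_1+[\eta,\mathscr{L}'\xi]_1$ and for which there is $\theta'\in\mathrm{Der}(P_0;P_1)$ such that $\boldsymbol{[}\mathcal{D}_{df},\mathscr{L}'\boldsymbol{]}=\mathrm{ad}_{\theta'(f)}$ and $\mathscr{L}'(\mathcal{K}(df,dg))=-(d_{\mathcal{D}}\theta')(f,g)$ for all $f,g\in P_0$. Its submodules are $\mathscr{C}_0(\mathcal{P})=\{\mathcal{D}_{dk}\mid k\in\mathrm{Casim}(\mathcal{P}_0)\}$ and $\mathrm{Inn}(P_1,[\,,\,]_1)=\{\mathrm{ad}_\eta\mid\eta\in P_1\}$. *)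

theory Defs
  imports "HOL-Algebra.Module" "HOL-Algebra.AbelCoset"
begin

section \<open>Modules, linear maps and quotients\<close>

text \<open>
  All objects are HOL-Algebra structures with explicit carriers.  A mere module is an element of
  the record type \<^type>\<open>module\<close>, whose inherited ring fields \<open>mult\<close> and \<open>one\<close> carry no meaning and are
  left \<open>undefined\<close>.
\<close>

definition restrict_scalars ::
    "('r, 'm) ring_scheme \<Rightarrow> ('r, 'a, 'n) module_scheme \<Rightarrow> ('a, 'b, 'k) module_scheme \<Rightarrow> ('r, 'b) module"
  where "restrict_scalars R A M =
    \<lparr>carrier = carrier M, monoid.mult = undefined, one = undefined,
     ring.zero = \<zero>\<^bsub>M\<^esub>, ring.add = add M, smult = (\<lambda>r x. (r \<odot>\<^bsub>A\<^esub> \<one>\<^bsub>A\<^esub>) \<odot>\<^bsub>M\<^esub> x)\<rparr>"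

definition generated_submodule ::
    "('r, 'm) ring_scheme \<Rightarrow> ('r, 'a, 'n) module_scheme \<Rightarrow> 'a set \<Rightarrow> 'a set"
  where "generated_submodule R M S = \<Inter> {N. submodule N R M \<and> S \<subseteq> N}"

text \<open>For a coset \<open>X = N + x\<close> the union below is the single coset \<open>N + r x\<close>.\<close>

definition quot_module :: "('r, 'a, 'n) module_scheme \<Rightarrow> 'a set \<Rightarrow> ('r, 'a set) module"
  where "quot_module M N =
    \<lparr>carrier = a_rcosets\<^bsub>M\<^esub> N, monoid.mult = undefined, one = undefined,
     ring.zero = N, ring.add = set_add M, smult = (\<lambda>r X. \<Union>x\<in>X. N +>\<^bsub>M\<^esub> (r \<odot>\<^bsub>M\<^esub> x))\<rparr>"

definition linear_maps ::
    "('r, 'm) ring_scheme \<Rightarrow> ('r, 'a, 'n) module_scheme \<Rightarrow> ('r, 'b, 'k) module_scheme \<Rightarrow> ('a \<Rightarrow> 'b) set"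
  where "linear_maps R M N =
    {\<phi> \<in> carrier M \<rightarrow>\<^sub>E carrier N.
       (\<forall>x \<in> carrier M. \<forall>y \<in> carrier M. \<phi> (x \<oplus>\<^bsub>M\<^esub> y) = \<phi> x \<oplus>\<^bsub>N\<^esub> \<phi> y) \<and>
       (\<forall>r \<in> carrier R. \<forall>x \<in> carrier M. \<phi> (r \<odot>\<^bsub>M\<^esub> x) = r \<odot>\<^bsub>N\<^esub> \<phi> x)}"

definition bilinear_map ::
    "('r, 'm) ring_scheme \<Rightarrow> ('r, 'a, 'n) module_scheme \<Rightarrow> ('r, 'b, 'k) module_scheme
      \<Rightarrow> ('r, 'c, 'l) module_scheme \<Rightarrow> ('a \<Rightarrow> 'b \<Rightarrow> 'c) \<Rightarrow> bool"
  where "bilinear_map R M N Q \<beta> \<longleftrightarrow>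
    (\<forall>x \<in> carrier M. \<forall>y \<in> carrier N. \<beta> x y \<in> carrier Q) \<and>
    (\<forall>x \<in> carrier M. \<forall>x' \<in> carrier M. \<forall>y \<in> carrier N. \<beta> (x \<oplus>\<^bsub>M\<^esub> x') y = \<beta> x y \<oplus>\<^bsub>Q\<^esub> \<beta> x' y) \<and>
    (\<forall>x \<in> carrier M. \<forall>y \<in> carrier N. \<forall>y' \<in> carrier N. \<beta> x (y \<oplus>\<^bsub>N\<^esub> y') = \<beta> x y \<oplus>\<^bsub>Q\<^esub> \<beta> x y') \<and>
    (\<forall>r \<in> carrier R. \<forall>x \<in> carrier M. \<forall>y \<in> carrier N. \<beta> (r \<odot>\<^bsub>M\<^esub> x) y = r \<odot>\<^bsub>Q\<^esub> \<beta> x y) \<and>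
    (\<forall>r \<in> carrier R. \<forall>x \<in> carrier M. \<forall>y \<in> carrier N. \<beta> x (r \<odot>\<^bsub>N\<^esub> y) = r \<odot>\<^bsub>Q\<^esub> \<beta> x y)"

definition isomorphic_modules ::
    "('r, 'm) ring_scheme \<Rightarrow> ('r, 'a, 'n) module_scheme \<Rightarrow> ('r, 'b, 'k) module_scheme \<Rightarrow> bool"
  where "isomorphic_modules R M N \<longleftrightarrow> (\<exists>\<phi> \<in> linear_maps R M N. bij_betw \<phi> (carrier M) (carrier N))"

text \<open>Maps between carriers are extensional, so that equality of maps is equality on the carrier.\<close>

definition map_module :: "('r, 'a, 'n) module_scheme \<Rightarrow> ('r, 'a \<Rightarrow> 'a) module"
  where "map_module M =
    \<lparr>carrier = carrier M \<rightarrow>\<^sub>E carrier M, monoid.mult = undefined, one = undefined,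
     ring.zero = (\<lambda>x \<in> carrier M. \<zero>\<^bsub>M\<^esub>),
     ring.add = (\<lambda>\<phi> \<psi>. \<lambda>x \<in> carrier M. \<phi> x \<oplus>\<^bsub>M\<^esub> \<psi> x),
     smult = (\<lambda>r \<phi>. \<lambda>x \<in> carrier M. r \<odot>\<^bsub>M\<^esub> \<phi> x)\<rparr>"

definition commutator :: "('r, 'a, 'n) module_scheme \<Rightarrow> ('a \<Rightarrow> 'a) \<Rightarrow> ('a \<Rightarrow> 'a) \<Rightarrow> 'a \<Rightarrow> 'a"
  where "commutator M \<phi> \<psi> = (\<lambda>x \<in> carrier M. \<phi> (\<psi> x) \<ominus>\<^bsub>M\<^esub> \<psi> (\<phi> x))"


section \<open>Lie algebras and Poisson algebras\<close>

locale lie_algebra = module R M for R (structure) and M (structure) +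
  fixes br :: "'c \<Rightarrow> 'c \<Rightarrow> 'c"
  assumes bilinear: "bilinear_map R M M M br"
    and alternating: "x \<in> carrier M \<Longrightarrow> br x x = \<zero>\<^bsub>M\<^esub>"
    and jacobi: "\<lbrakk>x \<in> carrier M; y \<in> carrier M; z \<in> carrier M\<rbrakk> \<Longrightarrow>
      br x (br y z) \<oplus>\<^bsub>M\<^esub> br y (br z x) \<oplus>\<^bsub>M\<^esub> br z (br x y) = \<zero>\<^bsub>M\<^esub>"

definition ad :: "('r, 'a, 'n) module_scheme \<Rightarrow> ('a \<Rightarrow> 'a \<Rightarrow> 'a) \<Rightarrow> 'a \<Rightarrow> 'a \<Rightarrow> 'a"
  where "ad M br x = (\<lambda>y \<in> carrier M. br x y)"

definition Inn :: "('r, 'a, 'n) module_scheme \<Rightarrow> ('a \<Rightarrow> 'a \<Rightarrow> 'a) \<Rightarrow> ('a \<Rightarrow> 'a) set"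
  where "Inn M br = ad M br ` carrier M"

definition perfect_lie ::
    "('r, 'm) ring_scheme \<Rightarrow> ('r, 'a, 'n) module_scheme \<Rightarrow> ('a \<Rightarrow> 'a \<Rightarrow> 'a) \<Rightarrow> bool"
  where "perfect_lie R M br \<longleftrightarrow>
    carrier M = generated_submodule R M {br x y | x y. x \<in> carrier M \<and> y \<in> carrier M}"

definition centerless_lie :: "('r, 'a, 'n) module_scheme \<Rightarrow> ('a \<Rightarrow> 'a \<Rightarrow> 'a) \<Rightarrow> bool"
  where "centerless_lie M br \<longleftrightarrow>
    (\<forall>x \<in> carrier M. (\<forall>y \<in> carrier M. br x y = \<zero>\<^bsub>M\<^esub>) \<longrightarrow> x = \<zero>\<^bsub>M\<^esub>)"

locale poisson_algebra = algebra R M + lie_algebra R M br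
  for R (structure) and M (structure) and br +
  assumes leibniz_left: "\<lbrakk>a \<in> carrier M; b \<in> carrier M; c \<in> carrier M\<rbrakk> \<Longrightarrow>
      br (a \<otimes>\<^bsub>M\<^esub> b) c = a \<otimes>\<^bsub>M\<^esub> br b c \<oplus>\<^bsub>M\<^esub> b \<otimes>\<^bsub>M\<^esub> br a c"
    and leibniz_right: "\<lbrakk>a \<in> carrier M; b \<in> carrier M; c \<in> carrier M\<rbrakk> \<Longrightarrow>
      br a (b \<otimes>\<^bsub>M\<^esub> c) = b \<otimes>\<^bsub>M\<^esub> br a c \<oplus>\<^bsub>M\<^esub> c \<otimes>\<^bsub>M\<^esub> br a b"

definition Casim :: "('r, 'a, 'n) module_scheme \<Rightarrow> ('a \<Rightarrow> 'a \<Rightarrow> 'a) \<Rightarrow> 'a set"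
  where "Casim A br = {k \<in> carrier A. \<forall>f \<in> carrier A. br k f = \<zero>\<^bsub>A\<^esub>}"

definition Poiss ::
    "('r, 'm) ring_scheme \<Rightarrow> ('r, 'a, 'n) module_scheme \<Rightarrow> ('a \<Rightarrow> 'a \<Rightarrow> 'a) \<Rightarrow> ('a \<Rightarrow> 'a) set"
  where "Poiss R Q br =
    {X \<in> linear_maps R Q Q.
       (\<forall>a \<in> carrier Q. \<forall>b \<in> carrier Q. X (a \<otimes>\<^bsub>Q\<^esub> b) = a \<otimes>\<^bsub>Q\<^esub> X b \<oplus>\<^bsub>Q\<^esub> b \<otimes>\<^bsub>Q\<^esub> X a) \<and>
       (\<forall>a \<in> carrier Q. \<forall>b \<in> carrier Q. X (br a b) = br (X a) b \<oplus>\<^bsub>Q\<^esub> br a (X b))}"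

definition Ham :: "('r, 'a, 'n) module_scheme \<Rightarrow> ('a \<Rightarrow> 'a \<Rightarrow> 'a) \<Rightarrow> ('a \<Rightarrow> 'a) set"
  where "Ham Q br = {\<lambda>a \<in> carrier Q. br q a | q. q \<in> carrier Q}"

definition poisson_H1 ::
    "('r, 'm) ring_scheme \<Rightarrow> ('r, 'a, 'n) module_scheme \<Rightarrow> ('a \<Rightarrow> 'a \<Rightarrow> 'a) \<Rightarrow> ('r, ('a \<Rightarrow> 'a) set) module"
  where "poisson_H1 R Q br = quot_module ((map_module Q)\<lparr>carrier := Poiss R Q br\<rparr>) (Ham Q br)"


section \<open>Kaehler differentials\<close>

definition free_module :: "('a, 'm) ring_scheme \<Rightarrow> 'i set \<Rightarrow> ('a, 'i \<Rightarrow> 'a) module"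
  where "free_module A S =
    \<lparr>carrier = {c. (\<forall>i \<in> S. c i \<in> carrier A) \<and> (\<forall>i. i \<notin> S \<longrightarrow> c i = \<zero>\<^bsub>A\<^esub>) \<and> finite {i. c i \<noteq> \<zero>\<^bsub>A\<^esub>}},
     monoid.mult = undefined, one = undefined,
     ring.zero = (\<lambda>i. \<zero>\<^bsub>A\<^esub>), ring.add = (\<lambda>c c' i. c i \<oplus>\<^bsub>A\<^esub> c' i), smult = (\<lambda>a c i. a \<otimes>\<^bsub>A\<^esub> c i)\<rparr>"

definition free_gen :: "('a, 'm) ring_scheme \<Rightarrow> 'i \<Rightarrow> 'i \<Rightarrow> 'a"
  where "free_gen A i = (\<lambda>j. if j = i then \<one>\<^bsub>A\<^esub> else \<zero>\<^bsub>A\<^esub>)"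

text \<open>
  The Kaehler differentials of \<open>A\<close> over \<open>R\<close> are the free \<open>A\<close>-module on symbols \<open>e f\<close> (\<open>f\<close> in \<open>A\<close>)
  modulo the relations making \<open>e\<close> into an \<open>R\<close>-linear derivation; \<open>kaehler_d f\<close> is the class of \<open>e f\<close>.
\<close>

definition kaehler_relations ::
    "('r, 'm) ring_scheme \<Rightarrow> ('r, 'a, 'n) module_scheme \<Rightarrow> ('a \<Rightarrow> 'a) set"
  where "kaehler_relations R A =
    (let F = free_module A (carrier A); e = free_gen A in
      {e (f \<oplus>\<^bsub>A\<^esub> g) \<ominus>\<^bsub>F\<^esub> (e f \<oplus>\<^bsub>F\<^esub> e g) | f g. f \<in> carrier A \<and> g \<in> carrier A} \<union>
      {e (r \<odot>\<^bsub>A\<^esub> f) \<ominus>\<^bsub>F\<^esub> (r \<odot>\<^bsub>A\<^esub> \<one>\<^bsub>A\<^esub>) \<odot>\<^bsub>F\<^esub> e f | r f. r \<in> carrier R \<and> f \<in> carrier A} \<union>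
      {e (f \<otimes>\<^bsub>A\<^esub> g) \<ominus>\<^bsub>F\<^esub> (f \<odot>\<^bsub>F\<^esub> e g \<oplus>\<^bsub>F\<^esub> g \<odot>\<^bsub>F\<^esub> e f) | f g. f \<in> carrier A \<and> g \<in> carrier A})"

definition kaehler_submodule ::
    "('r, 'm) ring_scheme \<Rightarrow> ('r, 'a, 'n) module_scheme \<Rightarrow> ('a \<Rightarrow> 'a) set"
  where "kaehler_submodule R A = generated_submodule A (free_module A (carrier A)) (kaehler_relations R A)"

definition kaehler ::
    "('r, 'm) ring_scheme \<Rightarrow> ('r, 'a, 'n) module_scheme \<Rightarrow> ('a, ('a \<Rightarrow> 'a) set) module"
  where "kaehler R A = quot_module (free_module A (carrier A)) (kaehler_submodule R A)"

definition kaehler_d ::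
    "('r, 'm) ring_scheme \<Rightarrow> ('r, 'a, 'n) module_scheme \<Rightarrow> 'a \<Rightarrow> ('a \<Rightarrow> 'a) set"
  where "kaehler_d R A f = kaehler_submodule R A +>\<^bsub>free_module A (carrier A)\<^esub> free_gen A f"

text \<open>
  A representative \<open>c\<close> of \<open>\<alpha>\<close> presents it as \<open>\<Sum>h. c h \<cdot> dh\<close>, so the value of the anchor on \<open>\<alpha>\<close> is
  \<open>\<Sum>h. c h \<cdot> {h, \<cdot>}\<close>, whichever representative is used.
\<close>

definition anchor ::
    "('r, 'a, 'n) module_scheme \<Rightarrow> ('a \<Rightarrow> 'a \<Rightarrow> 'a) \<Rightarrow> ('a \<Rightarrow> 'a) set \<Rightarrow> 'a \<Rightarrow> 'a"
  where "anchor A br \<alpha> f =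
    (THE y. \<exists>c \<in> \<alpha>. y = (\<Oplus>\<^bsub>A\<^esub>h \<in> {h \<in> carrier A. c h \<noteq> \<zero>\<^bsub>A\<^esub>}. c h \<otimes>\<^bsub>A\<^esub> br h f))"


section \<open>Admissible Poisson algebras and Poisson triples\<close>

definition Der ::
    "('r, 'm) ring_scheme \<Rightarrow> ('r, 'a, 'n) module_scheme \<Rightarrow> ('a, 'b, 'k) module_scheme \<Rightarrow> ('a \<Rightarrow> 'b) set"
  where "Der R A M =
    {\<theta> \<in> linear_maps R A (restrict_scalars R A M).
       \<forall>f \<in> carrier A. \<forall>g \<in> carrier A. \<theta> (f \<otimes>\<^bsub>A\<^esub> g) = f \<odot>\<^bsub>M\<^esub> \<theta> g \<oplus>\<^bsub>M\<^esub> g \<odot>\<^bsub>M\<^esub> \<theta> f}"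

definition faithful_module :: "('a, 'm) ring_scheme \<Rightarrow> ('a, 'b, 'k) module_scheme \<Rightarrow> bool"
  where "faithful_module A M \<longleftrightarrow>
    (\<forall>f \<in> carrier A. (\<forall>x \<in> carrier M. f \<odot>\<^bsub>M\<^esub> x = \<zero>\<^bsub>M\<^esub>) \<longrightarrow> f = \<zero>\<^bsub>A\<^esub>)"

definition semidirect ::
    "('r, 'm) ring_scheme \<Rightarrow> ('r, 'a, 'n) module_scheme \<Rightarrow> ('a, 'b, 'k) module_scheme
      \<Rightarrow> ('r, 'a \<times> 'b) module"
  where "semidirect R P0 P1 =
    \<lparr>carrier = carrier P0 \<times> carrier P1,
     monoid.mult = (\<lambda>(f, \<eta>) (g, \<xi>). (f \<otimes>\<^bsub>P0\<^esub> g, f \<odot>\<^bsub>P1\<^esub> \<xi> \<oplus>\<^bsub>P1\<^esub> g \<odot>\<^bsub>P1\<^esub> \<eta>)),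
     one = (\<one>\<^bsub>P0\<^esub>, \<zero>\<^bsub>P1\<^esub>),
     ring.zero = (\<zero>\<^bsub>P0\<^esub>, \<zero>\<^bsub>P1\<^esub>),
     ring.add = (\<lambda>(f, \<eta>) (g, \<xi>). (f \<oplus>\<^bsub>P0\<^esub> g, \<eta> \<oplus>\<^bsub>P1\<^esub> \<xi>)),
     smult = (\<lambda>r (f, \<eta>). (r \<odot>\<^bsub>P0\<^esub> f, r \<odot>\<^bsub>restrict_scalars R P0 P1\<^esub> \<eta>))\<rparr>"

locale admissible_poisson_algebra =
  P0: poisson_algebra R P0 br0 + P1: module P0 P1 + P: poisson_algebra R "semidirect R P0 P1" br
  for R and P0 and br0 and P1 and br +
  assumes faithful: "faithful_module P0 P1"
    and admissible: "\<lbrakk>f \<in> carrier P0; \<eta> \<in> carrier P1; g \<in> carrier P0; \<xi> \<in> carrier P1\<rbrakk> \<Longrightarrow>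
      fst (br (f, \<eta>) (g, \<xi>)) = br0 f g"

definition contravariant_derivative ::
    "('r, 'm) ring_scheme \<Rightarrow> ('r, 'a, 'n) module_scheme \<Rightarrow> ('a \<Rightarrow> 'a \<Rightarrow> 'a) \<Rightarrow> ('a, 'b, 'k) module_scheme
      \<Rightarrow> (('a \<Rightarrow> 'a) set \<Rightarrow> 'b \<Rightarrow> 'b) \<Rightarrow> bool"
  where "contravariant_derivative R P0 br0 P1 \<D> \<longleftrightarrow>
    bilinear_map R (restrict_scalars R P0 (kaehler R P0)) (restrict_scalars R P0 P1)
      (restrict_scalars R P0 P1) \<D> \<and>
    (\<forall>f \<in> carrier P0. \<forall>\<alpha> \<in> carrier (kaehler R P0). \<forall>\<eta> \<in> carrier P1.
       \<D> (f \<odot>\<^bsub>kaehler R P0\<^esub> \<alpha>) \<eta> = f \<odot>\<^bsub>P1\<^esub> \<D> \<alpha> \<eta>) \<and>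
    (\<forall>f \<in> carrier P0. \<forall>\<alpha> \<in> carrier (kaehler R P0). \<forall>\<eta> \<in> carrier P1.
       \<D> \<alpha> (f \<odot>\<^bsub>P1\<^esub> \<eta>) = f \<odot>\<^bsub>P1\<^esub> \<D> \<alpha> \<eta> \<oplus>\<^bsub>P1\<^esub> anchor P0 br0 \<alpha> f \<odot>\<^bsub>P1\<^esub> \<eta>)"

locale poisson_triple = admissible_poisson_algebra R P0 br0 P1 br +
  lie: lie_algebra P0 P1 br1
  for R :: "('r, 'm) ring_scheme" and P0 :: "('r, 'a, 'n) module_scheme" and br0
    and P1 :: "('a, 'b, 'k) module_scheme" and br and br1 +
  fixes \<D> :: "('a \<Rightarrow> 'a) set \<Rightarrow> 'b \<Rightarrow> 'b"
    and \<K> :: "('a \<Rightarrow> 'a) set \<Rightarrow> ('a \<Rightarrow> 'a) set \<Rightarrow> 'b"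
  assumes contravariant: "contravariant_derivative R P0 br0 P1 \<D>"
    and K_bilinear: "bilinear_map P0 (kaehler R P0) (kaehler R P0) P1 \<K>"
    and K_skew: "\<lbrakk>\<alpha> \<in> carrier (kaehler R P0); \<beta> \<in> carrier (kaehler R P0)\<rbrakk> \<Longrightarrow>
      \<K> \<alpha> \<beta> = \<ominus>\<^bsub>P1\<^esub> \<K> \<beta> \<alpha>"
    and bracket_eq: "\<lbrakk>f \<in> carrier P0; \<eta> \<in> carrier P1; g \<in> carrier P0; \<xi> \<in> carrier P1\<rbrakk> \<Longrightarrow>
      br (f, \<eta>) (g, \<xi>) =
        (br0 f g, \<D> (kaehler_d R P0 f) \<xi> \<ominus>\<^bsub>P1\<^esub> \<D> (kaehler_d R P0 g) \<eta> \<oplus>\<^bsub>P1\<^esub> br1 \<eta> \<xi>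
          \<oplus>\<^bsub>P1\<^esub> \<K> (kaehler_d R P0 f) (kaehler_d R P0 g))"

definition d_contravariant ::
    "('r, 'm) ring_scheme \<Rightarrow> ('r, 'a, 'n) module_scheme \<Rightarrow> ('a \<Rightarrow> 'a \<Rightarrow> 'a) \<Rightarrow> ('a, 'b, 'k) module_scheme
      \<Rightarrow> (('a \<Rightarrow> 'a) set \<Rightarrow> 'b \<Rightarrow> 'b) \<Rightarrow> ('a \<Rightarrow> 'b) \<Rightarrow> 'a \<Rightarrow> 'a \<Rightarrow> 'b"
  where "d_contravariant R P0 br0 P1 \<D> \<theta> f g =
    \<D> (kaehler_d R P0 f) (\<theta> g) \<ominus>\<^bsub>P1\<^esub> \<D> (kaehler_d R P0 g) (\<theta> f) \<ominus>\<^bsub>P1\<^esub> \<theta> (br0 f g)"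

definition M_zero ::
    "('r, 'm) ring_scheme \<Rightarrow> ('r, 'a, 'n) module_scheme \<Rightarrow> ('a \<Rightarrow> 'a \<Rightarrow> 'a) \<Rightarrow> ('a, 'b, 'k) module_scheme
      \<Rightarrow> ('b \<Rightarrow> 'b \<Rightarrow> 'b) \<Rightarrow> (('a \<Rightarrow> 'a) set \<Rightarrow> 'b \<Rightarrow> 'b) \<Rightarrow> (('a \<Rightarrow> 'a) set \<Rightarrow> ('a \<Rightarrow> 'a) set \<Rightarrow> 'b)
      \<Rightarrow> ('b \<Rightarrow> 'b) set"
  where "M_zero R P0 br0 P1 br1 \<D> \<K> =
    {L \<in> linear_maps P0 P1 P1.
       (\<forall>\<eta> \<in> carrier P1. \<forall>\<xi> \<in> carrier P1. L (br1 \<eta> \<xi>) = br1 (L \<eta>) \<xi> \<oplus>\<^bsub>P1\<^esub> br1 \<eta> (L \<xi>)) \<and>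
       (\<exists>\<theta> \<in> Der R P0 P1. \<forall>f \<in> carrier P0. \<forall>g \<in> carrier P0.
          commutator P1 (\<D> (kaehler_d R P0 f)) L = ad P1 br1 (\<theta> f) \<and>
          L (\<K> (kaehler_d R P0 f) (kaehler_d R P0 g)) =
            \<ominus>\<^bsub>P1\<^esub> d_contravariant R P0 br0 P1 \<D> \<theta> f g)}"

definition C_zero ::
    "('r, 'm) ring_scheme \<Rightarrow> ('r, 'a, 'n) module_scheme \<Rightarrow> ('a \<Rightarrow> 'a \<Rightarrow> 'a) \<Rightarrow> ('a, 'b, 'k) module_scheme
      \<Rightarrow> (('a \<Rightarrow> 'a) set \<Rightarrow> 'b \<Rightarrow> 'b) \<Rightarrow> ('b \<Rightarrow> 'b) set"
  where "C_zero R P0 br0 P1 \<D> = {\<lambda>\<eta> \<in> carrier P1. \<D> (kaehler_d R P0 k) \<eta> | k. k \<in> Casim P0 br0}"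

end

theory Submission
  imports Defs
begin

text \<open>
  A Poisson derivation \<open>X\<close> of the semidirect product maps the fibre \<open>P1\<close> into itself: the base component
  of its restriction to \<open>P1\<close> is \<open>P0\<close>-linear and vanishes on brackets, and \<open>P1\<close> is perfect.  Hence \<open>X\<close>
  induces a Poisson derivation of \<open>P0\<close>, which is Hamiltonian, and subtracting the Hamiltonian
  derivation of a potential leaves a vertical derivation, one that takes values in \<open>P1\<close>.  A vertical
  derivation is determined by its restriction \<open>L\<close> to \<open>P1\<close>, since the value \<open>t\<close> at \<open>f\<close> in \<open>P0\<close>
  satisfies \<open>L (D f \<eta>) - D f (L \<eta>) = [t, \<eta>]\<close> and \<open>P1\<close> is centerless.  The same equations, with
  \<open>\<theta> f = - t\<close>, say that the restrictions are exactly the elements of \<open>M_zero\<close>, and the vertical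
  Hamiltonian derivations, generated by \<open>(k, \<eta>)\<close> with \<open>k\<close> a Casimir, restrict to \<open>D k + ad \<eta>\<close>.
\<close>

section \<open>Quotient modules\<close>

lemma linear_mapsI:
  assumes "\<And>x. x \<in> carrier M \<Longrightarrow> \<phi> x \<in> carrier N"
    and "\<And>x. x \<notin> carrier M \<Longrightarrow> \<phi> x = undefined"
    and "\<And>x y. \<lbrakk>x \<in> carrier M; y \<in> carrier M\<rbrakk> \<Longrightarrow> \<phi> (x \<oplus>\<^bsub>M\<^esub> y) = \<phi> x \<oplus>\<^bsub>N\<^esub> \<phi> y"
    and "\<And>r x. \<lbrakk>r \<in> carrier R; x \<in> carrier M\<rbrakk> \<Longrightarrow> \<phi> (r \<odot>\<^bsub>M\<^esub> x) = r \<odot>\<^bsub>N\<^esub> \<phi> x"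
  shows "\<phi> \<in> linear_maps R M N"
  unfolding linear_maps_def using assms by (auto simp: PiE_iff extensional_def)

lemma
  assumes "\<phi> \<in> linear_maps R M N"
  shows linear_maps_closed: "x \<in> carrier M \<Longrightarrow> \<phi> x \<in> carrier N"
    and linear_maps_undefined: "x \<notin> carrier M \<Longrightarrow> \<phi> x = undefined"
    and linear_maps_add: "\<lbrakk>x \<in> carrier M; y \<in> carrier M\<rbrakk> \<Longrightarrow> \<phi> (x \<oplus>\<^bsub>M\<^esub> y) = \<phi> x \<oplus>\<^bsub>N\<^esub> \<phi> y"
    and linear_maps_smult: "\<lbrakk>r \<in> carrier R; x \<in> carrier M\<rbrakk> \<Longrightarrow> \<phi> (r \<odot>\<^bsub>M\<^esub> x) = r \<odot>\<^bsub>N\<^esub> \<phi> x"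
  using assms unfolding linear_maps_def by (auto simp: PiE_iff extensional_def)

text \<open>Cosets and set sums use only the addition of a record. A quotient of a submodule,
  written as a record with a smaller carrier, can therefore be computed in the ambient
  module.\<close>

lemma a_r_coset_carrier_update: "K +>\<^bsub>M\<lparr>carrier := C\<rparr>\<^esub> x = K +>\<^bsub>M\<^esub> x"
  by (simp add: a_r_coset_def')

lemma set_add_carrier_update: "K <+>\<^bsub>M\<lparr>carrier := C\<rparr>\<^esub> L = K <+>\<^bsub>M\<^esub> L"
  by (simp add: set_add_defs)

lemma (in module) submodule_abelian_subgroup:
  assumes "submodule H R M"
  shows "abelian_subgroup H M"
  using assms submodule.axioms(1) M.a_comm_group abelian_subgroupI2 by blast

text \<open>Well-definedness of the scalar multiplication in \<open>quot_module\<close>: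
  representatives of a coset differ by elements of \<open>H\<close>, and \<open>H\<close> absorbs
  scalars, so all cosets in the union coincide.\<close>

lemma (in module) quot_smult_coset:
  assumes H: "submodule H R M" and r: "r \<in> carrier R" and x: "x \<in> carrier M"
  shows "(\<Union>y\<in>H +>\<^bsub>M\<^esub> x. H +>\<^bsub>M\<^esub> (r \<odot>\<^bsub>M\<^esub> y)) = H +>\<^bsub>M\<^esub> (r \<odot>\<^bsub>M\<^esub> x)"
proof -
  interpret H: abelian_subgroup H M by (rule submodule_abelian_subgroup[OF H])
  have "H +>\<^bsub>M\<^esub> (r \<odot>\<^bsub>M\<^esub> y) = H +>\<^bsub>M\<^esub> (r \<odot>\<^bsub>M\<^esub> x)" if y: "y \<in> H +>\<^bsub>M\<^esub> x" for y
  proof -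
    obtain h where h: "h \<in> H" "y = h \<oplus>\<^bsub>M\<^esub> x"
      using y by (auto simp: a_r_coset_def')
    have "h \<in> carrier M" using h H.a_subset by blast
    then have "r \<odot>\<^bsub>M\<^esub> y = r \<odot>\<^bsub>M\<^esub> h \<oplus>\<^bsub>M\<^esub> r \<odot>\<^bsub>M\<^esub> x"
      using h r x smult_r_distr by simp
    moreover have "r \<odot>\<^bsub>M\<^esub> h \<in> H"
      using submodule.smult_closed[OF H] r h by blast
    ultimately have "r \<odot>\<^bsub>M\<^esub> y \<in> H +>\<^bsub>M\<^esub> (r \<odot>\<^bsub>M\<^esub> x)"
      by (auto simp: a_r_coset_def')
    then show ?thesis
      using M.a_repr_independence[OF _ _ H.a_subgroup] r x by auto
  qed
  \<comment> \<open>The index set of the union is nonempty, so a union of equal cosets is that coset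
    and not the empty set.\<close>
  moreover have "x \<in> H +>\<^bsub>M\<^esub> x" using H.a_rcos_self x by blast
  ultimately show ?thesis by blast
qed

text \<open>
  By the second isomorphism theorem the left quotient is \<open>N / (N \<inter> H)\<close>, which \<open>\<Psi>\<close> carries onto the
  right one.
\<close>

lemma isomorphic_quotI:
  assumes A: "module R A" and B: "module R B"
    and \<Psi>_closed: "\<And>x. x \<in> carrier A \<Longrightarrow> \<Psi> x \<in> carrier B"
    and \<Psi>_add: "\<And>x y. \<lbrakk>x \<in> carrier A; y \<in> carrier A\<rbrakk> \<Longrightarrow> \<Psi> (x \<oplus>\<^bsub>A\<^esub> y) = \<Psi> x \<oplus>\<^bsub>B\<^esub> \<Psi> y"
    and \<Psi>_smult: "\<And>r x. \<lbrakk>r \<in> carrier R; x \<in> carrier A\<rbrakk> \<Longrightarrow> \<Psi> (r \<odot>\<^bsub>A\<^esub> x) = r \<odot>\<^bsub>B\<^esub> \<Psi> x"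
    and S: "submodule S R A" and H: "submodule H R A" and N: "submodule N R A"
    and HS: "H \<subseteq> S" and NS: "N \<subseteq> S"
    and decomp: "\<And>x. x \<in> S \<Longrightarrow> \<exists>h \<in> H. \<exists>y \<in> N. x = h \<oplus>\<^bsub>A\<^esub> y"
    and ker: "\<And>x. \<lbrakk>x \<in> N; \<Psi> x = \<zero>\<^bsub>B\<^esub>\<rbrakk> \<Longrightarrow> x \<in> H"
  shows "isomorphic_modules R (quot_module (A\<lparr>carrier := S\<rparr>) H)
    (quot_module (B\<lparr>carrier := \<Psi> ` N\<rparr>) (\<Psi> ` (N \<inter> H)))"
proof -
  interpret A: module R A by (rule A)
  interpret B: module R B by (rule B)
  interpret H: abelian_subgroup H A by (rule A.submodule_abelian_subgroup[OF H])
  interpret N: abelian_subgroup N A by (rule A.submodule_abelian_subgroup[OF N])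
  define Q where "Q = \<Psi> ` (N \<inter> H)"
  have NA: "x \<in> carrier A" if "x \<in> N" for x using that N.a_subset by blast
  have HA: "x \<in> carrier A" if "x \<in> H" for x using that H.a_subset by blast
  have \<Psi>_zero: "\<Psi> \<zero>\<^bsub>A\<^esub> = \<zero>\<^bsub>B\<^esub>"
    using \<Psi>_smult[of "\<zero>\<^bsub>R\<^esub>" "\<zero>\<^bsub>A\<^esub>"] \<Psi>_closed by simp
  have \<Psi>_minus: "\<Psi> (\<ominus>\<^bsub>A\<^esub> x) = \<ominus>\<^bsub>B\<^esub> \<Psi> x" if "x \<in> carrier A" for x
    using \<Psi>_add[of x "\<ominus>\<^bsub>A\<^esub> x"] \<Psi>_closed \<Psi>_zero that
    by (metis A.M.a_inv_closed A.M.r_neg B.M.add.inv_unique' B.M.add.inv_equality B.M.a_comm)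
  have smH: "r \<odot>\<^bsub>A\<^esub> x \<in> H" if "r \<in> carrier R" "x \<in> H" for r x
    using submodule.smult_closed[OF H] that by blast
  have smN: "r \<odot>\<^bsub>A\<^esub> x \<in> N" if "r \<in> carrier R" "x \<in> N" for r x
    using submodule.smult_closed[OF N] that by blast
  have Q: "submodule Q R B"
  proof (rule B.submoduleI)
    show "Q \<subseteq> carrier B" unfolding Q_def using \<Psi>_closed NA by blast
    show "\<zero>\<^bsub>B\<^esub> \<in> Q" unfolding Q_def using \<Psi>_zero by (metis H.zero_closed IntI N.zero_closed imageI)
    show "\<ominus>\<^bsub>B\<^esub> a \<in> Q" if "a \<in> Q" for a
      using that unfolding Q_def
      by (auto simp: NA \<Psi>_minus[symmetric])
    show "a \<oplus>\<^bsub>B\<^esub> b \<in> Q" if "a \<in> Q" "b \<in> Q" for a b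
      using that unfolding Q_def
      by (auto simp: NA \<Psi>_add[symmetric])
    show "r \<odot>\<^bsub>B\<^esub> a \<in> Q" if "r \<in> carrier R" "a \<in> Q" for r a
      using that unfolding Q_def
      by (auto simp: NA \<Psi>_smult[symmetric] smH smN)
  qed
  interpret Q: abelian_subgroup Q B by (rule B.submodule_abelian_subgroup[OF Q])
  \<comment> \<open>By \<open>decomp\<close>, every coset of \<open>H\<close> in \<open>S\<close>
    has a representative in \<open>N\<close>.\<close>
  have rcosS: "a_rcosets\<^bsub>A\<lparr>carrier := S\<rparr>\<^esub> H = (\<lambda>y. H +>\<^bsub>A\<^esub> y) ` N"
  proof -
    have "H +>\<^bsub>A\<^esub> x \<in> (\<lambda>y. H +>\<^bsub>A\<^esub> y) ` N" if x: "x \<in> S" for x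
    proof -
      obtain h y where hy: "h \<in> H" "y \<in> N" "x = h \<oplus>\<^bsub>A\<^esub> y" using decomp[OF x] by blast
      then have "x \<in> H +>\<^bsub>A\<^esub> y" by (auto simp: a_r_coset_def')
      then have "H +>\<^bsub>A\<^esub> y = H +>\<^bsub>A\<^esub> x"
        using A.M.a_repr_independence[OF _ _ H.a_subgroup] hy NA by auto
      then show ?thesis using hy by blast
    qed
    then show ?thesis using NS by (auto simp: A_RCOSETS_def' a_r_coset_carrier_update)
  qed
  have rcosT: "a_rcosets\<^bsub>B\<lparr>carrier := \<Psi> ` N\<rparr>\<^esub> Q = (\<lambda>y. Q +>\<^bsub>B\<^esub> \<Psi> y) ` N"
    by (auto simp: A_RCOSETS_def' a_r_coset_carrier_update)
  \<comment> \<open>Nothing forces \<open>\<Psi>\<close> to map \<open>H\<close> into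
    \<open>Q\<close>, so only the part of a coset that lies in \<open>N\<close> is pushed forward.
    Taking the image of a set avoids a choice of representatives.\<close>
  define F where "F = (\<lambda>X \<in> (\<lambda>y. H +>\<^bsub>A\<^esub> y) ` N. \<Psi> ` (X \<inter> N))"
  have F: "F (H +>\<^bsub>A\<^esub> y) = Q +>\<^bsub>B\<^esub> \<Psi> y" if y: "y \<in> N" for y
  proof -
    \<comment> \<open>Two elements of \<open>N\<close> in the same coset of \<open>H\<close> differ
      by an element of \<open>N\<close> and \<open>H\<close>, and \<open>Q\<close> is the image of
      that intersection.\<close>
    have "h \<in> N" if "h \<in> H" "h \<oplus>\<^bsub>A\<^esub> y \<in> N" for h
    proof -
      have "h \<oplus>\<^bsub>A\<^esub> y \<oplus>\<^bsub>A\<^esub> \<ominus>\<^bsub>A\<^esub> y \<in> N" using that y by blast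
      then show ?thesis using that y NA HA by (simp add: A.M.a_assoc A.M.r_neg)
    qed
    then have *: "(H +>\<^bsub>A\<^esub> y) \<inter> N = (\<lambda>h. h \<oplus>\<^bsub>A\<^esub> y) ` (N \<inter> H)"
      using y by (auto simp: a_r_coset_def')
    have "\<Psi> ` (\<lambda>h. h \<oplus>\<^bsub>A\<^esub> y) ` (N \<inter> H) = (\<lambda>h. \<Psi> h \<oplus>\<^bsub>B\<^esub> \<Psi> y) ` (N \<inter> H)"
      unfolding image_image using y NA \<Psi>_add by (intro image_cong) auto
    then show ?thesis
      using y * by (auto simp: F_def Q_def a_r_coset_def')
  qed
  have "F \<in> linear_maps R (quot_module (A\<lparr>carrier := S\<rparr>) H) (quot_module (B\<lparr>carrier := \<Psi> ` N\<rparr>) Q)"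
  proof (rule linear_mapsI)
    fix X assume "X \<notin> carrier (quot_module (A\<lparr>carrier := S\<rparr>) H)"
    then show "F X = undefined" by (auto simp: quot_module_def rcosS F_def)
  next
    fix X assume "X \<in> carrier (quot_module (A\<lparr>carrier := S\<rparr>) H)"
    then obtain x where x: "x \<in> N" "X = H +>\<^bsub>A\<^esub> x" by (auto simp: quot_module_def rcosS)
    show "F X \<in> carrier (quot_module (B\<lparr>carrier := \<Psi> ` N\<rparr>) Q)"
      using x F by (auto simp: quot_module_def rcosT)
    show "F (r \<odot>\<^bsub>quot_module (A\<lparr>carrier := S\<rparr>) H\<^esub> X) = r \<odot>\<^bsub>quot_module (B\<lparr>carrier := \<Psi> ` N\<rparr>) Q\<^esub> F X"
      if r: "r \<in> carrier R" for r
      using x F smN[OF r] A.quot_smult_coset[OF H r] B.quot_smult_coset[OF Q r] NA \<Psi>_closed \<Psi>_smult r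
      by (simp add: quot_module_def a_r_coset_carrier_update)
    fix Y assume "Y \<in> carrier (quot_module (A\<lparr>carrier := S\<rparr>) H)"
    then obtain y where y: "y \<in> N" "Y = H +>\<^bsub>A\<^esub> y" by (auto simp: quot_module_def rcosS)
    have xy: "x \<in> carrier A" "y \<in> carrier A" using x y NA by auto
    have "F ((H +>\<^bsub>A\<^esub> x) <+>\<^bsub>A\<^esub> (H +>\<^bsub>A\<^esub> y)) = F (H +>\<^bsub>A\<^esub> (x \<oplus>\<^bsub>A\<^esub> y))"
      by (simp only: H.a_rcos_sum[OF xy])
    also have "\<dots> = Q +>\<^bsub>B\<^esub> \<Psi> (x \<oplus>\<^bsub>A\<^esub> y)"
      by (rule F) (use x y in blast)
    also have "\<dots> = Q +>\<^bsub>B\<^esub> (\<Psi> x \<oplus>\<^bsub>B\<^esub> \<Psi> y)"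
      by (simp only: \<Psi>_add[OF xy])
    also have "\<dots> = (Q +>\<^bsub>B\<^esub> \<Psi> x) <+>\<^bsub>B\<^esub> (Q +>\<^bsub>B\<^esub> \<Psi> y)"
      by (rule Q.a_rcos_sum[symmetric]) (use xy \<Psi>_closed in auto)
    finally have "F ((H +>\<^bsub>A\<^esub> x) <+>\<^bsub>A\<^esub> (H +>\<^bsub>A\<^esub> y)) = (Q +>\<^bsub>B\<^esub> \<Psi> x) <+>\<^bsub>B\<^esub> (Q +>\<^bsub>B\<^esub> \<Psi> y)" .
    then show "F (X \<oplus>\<^bsub>quot_module (A\<lparr>carrier := S\<rparr>) H\<^esub> Y)
        = F X \<oplus>\<^bsub>quot_module (B\<lparr>carrier := \<Psi> ` N\<rparr>) Q\<^esub> F Y"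
      using x y F[OF x(1)] F[OF y(1)] by (simp add: quot_module_def set_add_carrier_update)
  qed
  moreover have "bij_betw F (carrier (quot_module (A\<lparr>carrier := S\<rparr>) H))
      (carrier (quot_module (B\<lparr>carrier := \<Psi> ` N\<rparr>) Q))"
    unfolding bij_betw_def
  proof
    show "F ` carrier (quot_module (A\<lparr>carrier := S\<rparr>) H) = carrier (quot_module (B\<lparr>carrier := \<Psi> ` N\<rparr>) Q)"
      by (simp add: quot_module_def rcosS rcosT image_image F)
    have inj: "H +>\<^bsub>A\<^esub> x = H +>\<^bsub>A\<^esub> y" if xy: "x \<in> N" "y \<in> N" and eq: "Q +>\<^bsub>B\<^esub> \<Psi> x = Q +>\<^bsub>B\<^esub> \<Psi> y" for x y
    proof -
      have "\<Psi> x \<in> Q +>\<^bsub>B\<^esub> \<Psi> y" using eq Q.a_rcos_self[of "\<Psi> x"] xy NA \<Psi>_closed by auto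
      then obtain n where n: "n \<in> N" "n \<in> H" "\<Psi> x = \<Psi> n \<oplus>\<^bsub>B\<^esub> \<Psi> y"
        by (auto simp: a_r_coset_def' Q_def)
      \<comment> \<open>\<open>z\<close> measures how far \<open>x\<close> is from \<open>n\<close>
        plus \<open>y\<close>. Its image under \<open>\<Psi>\<close> vanishes, so \<open>ker\<close>
        puts it into \<open>H\<close>, and then \<open>x\<close> differs from \<open>y\<close> by
        \<open>z\<close> plus \<open>n\<close>, again in \<open>H\<close>.\<close>
      define z where "z = x \<oplus>\<^bsub>A\<^esub> \<ominus>\<^bsub>A\<^esub> (n \<oplus>\<^bsub>A\<^esub> y)"
      have z: "z \<in> N" using xy n unfolding z_def by blast
      have "\<Psi> z = \<zero>\<^bsub>B\<^esub>"
        using xy n NA \<Psi>_closed by (simp add: z_def \<Psi>_add \<Psi>_minus B.M.r_neg)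
      then have "z \<in> H" using ker z by blast
      then have "z \<oplus>\<^bsub>A\<^esub> n \<in> H" using n by blast
      moreover have "x = z \<oplus>\<^bsub>A\<^esub> n \<oplus>\<^bsub>A\<^esub> y"
        using xy n NA by (simp add: z_def A.M.a_assoc A.M.l_neg)
      ultimately have "x \<in> H +>\<^bsub>A\<^esub> y" by (auto simp: a_r_coset_def')
      then show ?thesis using A.M.a_repr_independence[OF _ _ H.a_subgroup] xy NA by auto
    qed
    show "inj_on F (carrier (quot_module (A\<lparr>carrier := S\<rparr>) H))"
    proof (rule inj_onI)
      fix X Y assume "X \<in> carrier (quot_module (A\<lparr>carrier := S\<rparr>) H)"
        "Y \<in> carrier (quot_module (A\<lparr>carrier := S\<rparr>) H)" and eq: "F X = F Y"
      then obtain x y where xy: "x \<in> N" "X = H +>\<^bsub>A\<^esub> x" "y \<in> N" "Y = H +>\<^bsub>A\<^esub> y"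
        by (auto simp: quot_module_def rcosS)
      show "X = Y" using inj[OF xy(1,3)] eq F[OF xy(1)] F[OF xy(3)] xy(2,4) by metis
    qed
  qed
  ultimately show ?thesis unfolding isomorphic_modules_def Q_def by blast
qed

section \<open>Modules of maps\<close>

lemma map_module_simps [simp]:
  "carrier (map_module M) = carrier M \<rightarrow>\<^sub>E carrier M"
  "\<zero>\<^bsub>map_module M\<^esub> = (\<lambda>x \<in> carrier M. \<zero>\<^bsub>M\<^esub>)"
  "\<phi> \<oplus>\<^bsub>map_module M\<^esub> \<psi> = (\<lambda>x \<in> carrier M. \<phi> x \<oplus>\<^bsub>M\<^esub> \<psi> x)"
  "r \<odot>\<^bsub>map_module M\<^esub> \<phi> = (\<lambda>x \<in> carrier M. r \<odot>\<^bsub>M\<^esub> \<phi> x)"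
  by (simp_all add: map_module_def)

text \<open>All axioms hold pointwise; the extensional carrier is what turns pointwise identities
  into equalities of maps.\<close>

lemma module_map_module:
  assumes "module R M"
  shows "module R (map_module M)"
proof -
  interpret module R M by (rule assms)
  have cl: "\<phi> x \<in> carrier M" if "\<phi> \<in> carrier M \<rightarrow>\<^sub>E carrier M" "x \<in> carrier M" for \<phi> x
    using that by (rule PiE_mem)
  have ext: "(\<lambda>x \<in> carrier M. \<phi> x) = \<phi>" if "\<phi> \<in> carrier M \<rightarrow>\<^sub>E carrier M" for \<phi>
    using that by (simp add: PiE_def extensional_restrict)
  show ?thesis
  proof (rule moduleI)
    show "cring R" by (rule R.is_cring)
    show "abelian_group (map_module M)"
    proof (rule abelian_groupI)
      fix \<phi> assume "\<phi> \<in> carrier (map_module M)"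
      then show "\<exists>\<psi> \<in> carrier (map_module M). \<psi> \<oplus>\<^bsub>map_module M\<^esub> \<phi> = \<zero>\<^bsub>map_module M\<^esub>"
        by (intro bexI[of _ "\<lambda>x \<in> carrier M. \<ominus>\<^bsub>M\<^esub> \<phi> x"])
          (simp_all add: cl M.l_neg cong: restrict_cong)
    qed (simp_all add: cl ext M.a_ac cong: restrict_cong)
  qed (simp_all add: cl ext smult_l_distr smult_r_distr smult_assoc1 cong: restrict_cong)
qed

lemma map_module_minus:
  assumes "module R M" and \<phi>: "\<phi> \<in> carrier M \<rightarrow>\<^sub>E carrier M"
  shows "\<ominus>\<^bsub>map_module M\<^esub> \<phi> = (\<lambda>x \<in> carrier M. \<ominus>\<^bsub>M\<^esub> \<phi> x)"
proof -
  interpret module R M by (rule assms)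
  interpret F: module R "map_module M" by (rule module_map_module[OF assms(1)])
  have "\<phi> x \<in> carrier M" if "x \<in> carrier M" for x
    using \<phi> that by (rule PiE_mem)
  with \<phi> show ?thesis
    by (intro F.M.minus_equality) (simp_all add: M.l_neg cong: restrict_cong)
qed

section \<open>Poisson derivations\<close>

context lie_algebra
begin

lemma br_closed [simp, intro]: "\<lbrakk>x \<in> carrier M; y \<in> carrier M\<rbrakk> \<Longrightarrow> br x y \<in> carrier M"
  using bilinear unfolding bilinear_map_def by blast

lemma br_add_left:
  "\<lbrakk>x \<in> carrier M; y \<in> carrier M; z \<in> carrier M\<rbrakk> \<Longrightarrow> br (x \<oplus>\<^bsub>M\<^esub> y) z = br x z \<oplus>\<^bsub>M\<^esub> br y z"
  using bilinear unfolding bilinear_map_def by blast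

lemma br_add_right:
  "\<lbrakk>x \<in> carrier M; y \<in> carrier M; z \<in> carrier M\<rbrakk> \<Longrightarrow> br x (y \<oplus>\<^bsub>M\<^esub> z) = br x y \<oplus>\<^bsub>M\<^esub> br x z"
  using bilinear unfolding bilinear_map_def by blast

lemma br_smult_left:
  "\<lbrakk>r \<in> carrier R; x \<in> carrier M; y \<in> carrier M\<rbrakk> \<Longrightarrow> br (r \<odot>\<^bsub>M\<^esub> x) y = r \<odot>\<^bsub>M\<^esub> br x y"
  using bilinear unfolding bilinear_map_def by blast

lemma br_smult_right:
  "\<lbrakk>r \<in> carrier R; x \<in> carrier M; y \<in> carrier M\<rbrakk> \<Longrightarrow> br x (r \<odot>\<^bsub>M\<^esub> y) = r \<odot>\<^bsub>M\<^esub> br x y"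
  using bilinear unfolding bilinear_map_def by blast

lemma br_zero_left [simp]: "x \<in> carrier M \<Longrightarrow> br \<zero>\<^bsub>M\<^esub> x = \<zero>\<^bsub>M\<^esub>"
  using br_smult_left[of "\<zero>\<^bsub>R\<^esub>" "\<zero>\<^bsub>M\<^esub>" x] by simp

lemma br_zero_right [simp]: "x \<in> carrier M \<Longrightarrow> br x \<zero>\<^bsub>M\<^esub> = \<zero>\<^bsub>M\<^esub>"
  using br_smult_right[of "\<zero>\<^bsub>R\<^esub>" x "\<zero>\<^bsub>M\<^esub>"] by simp

lemma br_minus_left:
  assumes "x \<in> carrier M" "y \<in> carrier M"
  shows "br (\<ominus>\<^bsub>M\<^esub> x) y = \<ominus>\<^bsub>M\<^esub> br x y"
proof (rule M.minus_equality[symmetric])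
  have "br (\<ominus>\<^bsub>M\<^esub> x) y \<oplus>\<^bsub>M\<^esub> br x y = br (\<ominus>\<^bsub>M\<^esub> x \<oplus>\<^bsub>M\<^esub> x) y"
    using assms by (simp only: br_add_left M.a_inv_closed)
  also have "\<dots> = \<zero>\<^bsub>M\<^esub>" using assms by (simp add: M.l_neg)
  finally show "br (\<ominus>\<^bsub>M\<^esub> x) y \<oplus>\<^bsub>M\<^esub> br x y = \<zero>\<^bsub>M\<^esub>" .
qed (use assms in auto)

lemma br_minus_right:
  assumes "x \<in> carrier M" "y \<in> carrier M"
  shows "br x (\<ominus>\<^bsub>M\<^esub> y) = \<ominus>\<^bsub>M\<^esub> br x y"
proof (rule M.minus_equality[symmetric])
  have "br x (\<ominus>\<^bsub>M\<^esub> y) \<oplus>\<^bsub>M\<^esub> br x y = br x (\<ominus>\<^bsub>M\<^esub> y \<oplus>\<^bsub>M\<^esub> y)"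
    using assms by (simp only: br_add_right M.a_inv_closed)
  also have "\<dots> = \<zero>\<^bsub>M\<^esub>" using assms by (simp add: M.l_neg)
  finally show "br x (\<ominus>\<^bsub>M\<^esub> y) \<oplus>\<^bsub>M\<^esub> br x y = \<zero>\<^bsub>M\<^esub>" .
qed (use assms in auto)

text \<open>Polarization: expand the vanishing bracket of \<open>x\<close> plus \<open>y\<close>
  with itself.\<close>

lemma br_skew:
  assumes "x \<in> carrier M" "y \<in> carrier M"
  shows "br x y = \<ominus>\<^bsub>M\<^esub> br y x"
proof (rule M.minus_equality[symmetric])
  have "br (x \<oplus>\<^bsub>M\<^esub> y) (x \<oplus>\<^bsub>M\<^esub> y) = br x x \<oplus>\<^bsub>M\<^esub> br x y \<oplus>\<^bsub>M\<^esub> (br y x \<oplus>\<^bsub>M\<^esub> br y y)"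
    using assms by (simp add: br_add_left br_add_right M.a_ac)
  then show "br x y \<oplus>\<^bsub>M\<^esub> br y x = \<zero>\<^bsub>M\<^esub>"
    using assms by (simp add: alternating)
qed (use assms in auto)

text \<open>The cyclic Jacobi identity in the form that bracketing with \<open>x\<close> is a
  derivation of the bracket, which is how Hamiltonian derivations meet the condition in
  \<open>Poiss\<close>.\<close>

lemma br_derivation:
  assumes "x \<in> carrier M" "y \<in> carrier M" "z \<in> carrier M"
  shows "br x (br y z) = br (br x y) z \<oplus>\<^bsub>M\<^esub> br y (br x z)"
proof -
  have "br x (br y z) \<oplus>\<^bsub>M\<^esub> (br y (br z x) \<oplus>\<^bsub>M\<^esub> br z (br x y)) = \<zero>\<^bsub>M\<^esub>"
    using jacobi[of x y z] assms by (simp add: M.a_assoc)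
  then have "br x (br y z) = \<ominus>\<^bsub>M\<^esub> (br y (br z x) \<oplus>\<^bsub>M\<^esub> br z (br x y))"
    by (intro M.minus_equality[symmetric]) (use assms in auto)
  also have "\<dots> = \<ominus>\<^bsub>M\<^esub> br y (br z x) \<oplus>\<^bsub>M\<^esub> \<ominus>\<^bsub>M\<^esub> br z (br x y)"
    using assms by (simp add: M.minus_add)
  also have "\<ominus>\<^bsub>M\<^esub> br z (br x y) = br (br x y) z"
    using br_skew[of "br x y" z] assms by simp
  also have "\<ominus>\<^bsub>M\<^esub> br y (br z x) = br y (br x z)"
    using br_skew[of x z] assms by (simp add: br_minus_right)
  finally show ?thesis using assms by (simp add: M.a_comm)
qed

end

section \<open>Poisson and Hamiltonian derivations as submodules\<close>

lemma
  assumes "X \<in> Poiss R Q br"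
  shows Poiss_linear: "X \<in> linear_maps R Q Q"
    and Poiss_mult: "\<lbrakk>a \<in> carrier Q; b \<in> carrier Q\<rbrakk> \<Longrightarrow>
      X (a \<otimes>\<^bsub>Q\<^esub> b) = a \<otimes>\<^bsub>Q\<^esub> X b \<oplus>\<^bsub>Q\<^esub> b \<otimes>\<^bsub>Q\<^esub> X a"
    and Poiss_br: "\<lbrakk>a \<in> carrier Q; b \<in> carrier Q\<rbrakk> \<Longrightarrow> X (br a b) = br (X a) b \<oplus>\<^bsub>Q\<^esub> br a (X b)"
  using assms unfolding Poiss_def by auto

lemma PoissI:
  assumes "X \<in> linear_maps R Q Q"
    and "\<And>a b. \<lbrakk>a \<in> carrier Q; b \<in> carrier Q\<rbrakk> \<Longrightarrow> X (a \<otimes>\<^bsub>Q\<^esub> b) = a \<otimes>\<^bsub>Q\<^esub> X b \<oplus>\<^bsub>Q\<^esub> b \<otimes>\<^bsub>Q\<^esub> X a"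
    and "\<And>a b. \<lbrakk>a \<in> carrier Q; b \<in> carrier Q\<rbrakk> \<Longrightarrow> X (br a b) = br (X a) b \<oplus>\<^bsub>Q\<^esub> br a (X b)"
  shows "X \<in> Poiss R Q br"
  using assms unfolding Poiss_def by blast

lemma (in module) linear_maps_zero:
  assumes "X \<in> linear_maps R M N" and "module R N"
  shows "X \<zero>\<^bsub>M\<^esub> = \<zero>\<^bsub>N\<^esub>"
proof -
  interpret N: module R N by (rule assms(2))
  show ?thesis
    using linear_maps_smult[OF assms(1), of "\<zero>\<^bsub>R\<^esub>" "\<zero>\<^bsub>M\<^esub>"] linear_maps_closed[OF assms(1), of "\<zero>\<^bsub>M\<^esub>"] by simp
qed

context poisson_algebra
begin

lemma submodule_Poiss: "submodule (Poiss R M br) R (map_module M)"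
proof -
  interpret F: module R "map_module M" by (rule module_map_module[OF module])
  have cl: "X x \<in> carrier M" if "X \<in> Poiss R M br" "x \<in> carrier M" for X x
    using linear_maps_closed[OF Poiss_linear[OF that(1)] that(2)] .
  have car: "X \<in> carrier M \<rightarrow>\<^sub>E carrier M" if "X \<in> Poiss R M br" for X
    using Poiss_linear[OF that] unfolding linear_maps_def by blast
  \<comment> \<open>Proved ahead of the submodule conditions because closure under negation is
    deduced from it with the scalar minus one.\<close>
  have sm: "r \<odot>\<^bsub>map_module M\<^esub> X \<in> Poiss R M br" if r: "r \<in> carrier R" and X: "X \<in> Poiss R M br" for r X
  proof (rule PoissI, rule linear_mapsI)
    note X_simps = cl[OF X] linear_maps_add[OF Poiss_linear[OF X]]
      linear_maps_smult[OF Poiss_linear[OF X]] Poiss_mult[OF X] Poiss_br[OF X]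
    \<comment> \<open>\<open>smult_assoc2\<close> moves a scalar out of the left factor only;
      commutativity of the product gives the right factor.\<close>
    have mult: "a \<otimes>\<^bsub>M\<^esub> (r \<odot>\<^bsub>M\<^esub> b) = r \<odot>\<^bsub>M\<^esub> (a \<otimes>\<^bsub>M\<^esub> b)" if "a \<in> carrier M" "b \<in> carrier M" for a b
      using smult_assoc2[OF r that(2,1)] r that by (simp add: m_comm)
    fix a assume a: "a \<in> carrier M"
    show "(r \<odot>\<^bsub>map_module M\<^esub> X) a \<in> carrier M" using r a by (simp add: X_simps)
    show "(r \<odot>\<^bsub>map_module M\<^esub> X) (s \<odot>\<^bsub>M\<^esub> a) = s \<odot>\<^bsub>M\<^esub> (r \<odot>\<^bsub>map_module M\<^esub> X) a"
      if s: "s \<in> carrier R" for s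
      using smult_assoc1[OF r s, of "X a"] smult_assoc1[OF s r, of "X a"] r s a
      by (simp add: X_simps R.m_comm)
    fix b assume b: "b \<in> carrier M"
    show "(r \<odot>\<^bsub>map_module M\<^esub> X) (a \<oplus>\<^bsub>M\<^esub> b) = (r \<odot>\<^bsub>map_module M\<^esub> X) a \<oplus>\<^bsub>M\<^esub> (r \<odot>\<^bsub>map_module M\<^esub> X) b"
      using r a b by (simp add: X_simps smult_r_distr)
    show "(r \<odot>\<^bsub>map_module M\<^esub> X) (a \<otimes>\<^bsub>M\<^esub> b)
        = a \<otimes>\<^bsub>M\<^esub> (r \<odot>\<^bsub>map_module M\<^esub> X) b \<oplus>\<^bsub>M\<^esub> b \<otimes>\<^bsub>M\<^esub> (r \<odot>\<^bsub>map_module M\<^esub> X) a"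
      using r a b by (simp add: X_simps smult_r_distr mult)
    show "(r \<odot>\<^bsub>map_module M\<^esub> X) (br a b)
        = br ((r \<odot>\<^bsub>map_module M\<^esub> X) a) b \<oplus>\<^bsub>M\<^esub> br a ((r \<odot>\<^bsub>map_module M\<^esub> X) b)"
      using r a b by (simp add: X_simps smult_r_distr br_smult_left br_smult_right)
  qed simp
  show ?thesis
  proof (rule F.submoduleI)
    show "Poiss R M br \<subseteq> carrier (map_module M)" using car by auto
    show "\<zero>\<^bsub>map_module M\<^esub> \<in> Poiss R M br"
      by (rule PoissI, rule linear_mapsI) simp_all
    show "X \<oplus>\<^bsub>map_module M\<^esub> Y \<in> Poiss R M br" if X: "X \<in> Poiss R M br" and Y: "Y \<in> Poiss R M br" for X Y
      by (rule PoissI, rule linear_mapsI)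
        (simp_all add: cl[OF X] cl[OF Y] linear_maps_add[OF Poiss_linear[OF X]]
          linear_maps_add[OF Poiss_linear[OF Y]] linear_maps_smult[OF Poiss_linear[OF X]]
          linear_maps_smult[OF Poiss_linear[OF Y]] Poiss_mult[OF X] Poiss_mult[OF Y]
          Poiss_br[OF X] Poiss_br[OF Y] smult_r_distr br_add_left br_add_right r_distr M.a_ac)
    show "r \<odot>\<^bsub>map_module M\<^esub> X \<in> Poiss R M br" if "r \<in> carrier R" "X \<in> Poiss R M br" for r X
      using that by (rule sm)
    show "\<ominus>\<^bsub>map_module M\<^esub> X \<in> Poiss R M br" if X: "X \<in> Poiss R M br" for X
    proof -
      have "\<ominus>\<^bsub>map_module M\<^esub> X = (\<ominus>\<^bsub>R\<^esub> \<one>\<^bsub>R\<^esub>) \<odot>\<^bsub>map_module M\<^esub> X"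
        using car[OF X] F.smult_l_minus[of "\<one>\<^bsub>R\<^esub>" X] by (simp del: map_module_simps(4) add: F.smult_one)
      then show ?thesis using sm[OF _ X] by simp
    qed
  qed
qed

text \<open>The rule for products is \<open>leibniz_right\<close>, the rule for brackets is the
  Jacobi identity.\<close>

lemma Ham_subset_Poiss: "Ham M br \<subseteq> Poiss R M br"
proof -
  have "(\<lambda>a \<in> carrier M. br q a) \<in> Poiss R M br" if "q \<in> carrier M" for q
    by (rule PoissI, rule linear_mapsI)
      (use that br_derivation[OF that] in \<open>simp_all add: br_add_right br_smult_right leibniz_right\<close>)
  then show ?thesis unfolding Ham_def by blast
qed

lemma submodule_Ham: "submodule (Ham M br) R (map_module M)"
proof -
  interpret F: module R "map_module M" by (rule module_map_module[OF module])
  show ?thesis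
  proof (rule F.submoduleI)
    show "Ham M br \<subseteq> carrier (map_module M)" by (auto simp: Ham_def)
    show "\<zero>\<^bsub>map_module M\<^esub> \<in> Ham M br"
      unfolding Ham_def by (intro CollectI exI[of _ "\<zero>\<^bsub>M\<^esub>"]) (simp cong: restrict_cong)
    fix X assume "X \<in> Ham M br"
    then obtain q where q: "q \<in> carrier M" "X = (\<lambda>a \<in> carrier M. br q a)" by (auto simp: Ham_def)
    show "\<ominus>\<^bsub>map_module M\<^esub> X \<in> Ham M br"
      unfolding Ham_def using q
      by (intro CollectI exI[of _ "\<ominus>\<^bsub>M\<^esub> q"])
        (simp add: map_module_minus[OF module] br_minus_left cong: restrict_cong)
    show "r \<odot>\<^bsub>map_module M\<^esub> X \<in> Ham M br" if r: "r \<in> carrier R" for r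
      unfolding Ham_def using q r
      by (intro CollectI exI[of _ "r \<odot>\<^bsub>M\<^esub> q"]) (simp add: br_smult_left cong: restrict_cong)
    fix Y assume "Y \<in> Ham M br"
    then obtain p where p: "p \<in> carrier M" "Y = (\<lambda>a \<in> carrier M. br p a)" by (auto simp: Ham_def)
    show "X \<oplus>\<^bsub>map_module M\<^esub> Y \<in> Ham M br"
      unfolding Ham_def using q p
      by (intro CollectI exI[of _ "q \<oplus>\<^bsub>M\<^esub> p"]) (simp add: br_add_left cong: restrict_cong)
  qed
qed

text \<open>The zero of the quotient is the coset \<open>Ham M br\<close> itself. If it is the only
  coset, then the coset of \<open>X\<close> equals it, and so \<open>X\<close> lies in it.\<close>

lemma Poiss_subset_Ham:
  assumes "carrier (poisson_H1 R M br) = {\<zero>\<^bsub>poisson_H1 R M br\<^esub>}"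
  shows "Poiss R M br \<subseteq> Ham M br"
proof
  fix X assume X: "X \<in> Poiss R M br"
  interpret F: module R "map_module M" by (rule module_map_module[OF module])
  have "Ham M br +>\<^bsub>map_module M\<^esub> X \<in> carrier (poisson_H1 R M br)"
    using X by (auto simp: poisson_H1_def quot_module_def A_RCOSETS_def' a_r_coset_carrier_update)
  then have eq: "Ham M br +>\<^bsub>map_module M\<^esub> X = Ham M br"
    using assms by (simp add: poisson_H1_def quot_module_def)
  have "X \<in> carrier (map_module M)"
    using X submodule_Poiss F.submoduleE(1) by blast
  then show "X \<in> Ham M br"
    using F.M.a_coset_join1[OF eq] submodule.axioms(1)[OF submodule_Ham] by blast
qed

end

section \<open>Semidirect products\<close>

lemma restrict_scalars_simps [simp]:
  "carrier (restrict_scalars R A M) = carrier M"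
  "\<zero>\<^bsub>restrict_scalars R A M\<^esub> = \<zero>\<^bsub>M\<^esub>"
  "x \<oplus>\<^bsub>restrict_scalars R A M\<^esub> y = x \<oplus>\<^bsub>M\<^esub> y"
  "r \<odot>\<^bsub>restrict_scalars R A M\<^esub> x = (r \<odot>\<^bsub>A\<^esub> \<one>\<^bsub>A\<^esub>) \<odot>\<^bsub>M\<^esub> x"
  by (simp_all add: restrict_scalars_def)

lemma semidirect_simps [simp]:
  "carrier (semidirect R A M) = carrier A \<times> carrier M"
  "(f, \<eta>) \<otimes>\<^bsub>semidirect R A M\<^esub> (g, \<xi>) = (f \<otimes>\<^bsub>A\<^esub> g, f \<odot>\<^bsub>M\<^esub> \<xi> \<oplus>\<^bsub>M\<^esub> g \<odot>\<^bsub>M\<^esub> \<eta>)"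
  "\<zero>\<^bsub>semidirect R A M\<^esub> = (\<zero>\<^bsub>A\<^esub>, \<zero>\<^bsub>M\<^esub>)"
  "(f, \<eta>) \<oplus>\<^bsub>semidirect R A M\<^esub> (g, \<xi>) = (f \<oplus>\<^bsub>A\<^esub> g, \<eta> \<oplus>\<^bsub>M\<^esub> \<xi>)"
  "r \<odot>\<^bsub>semidirect R A M\<^esub> (f, \<eta>) = (r \<odot>\<^bsub>A\<^esub> f, (r \<odot>\<^bsub>A\<^esub> \<one>\<^bsub>A\<^esub>) \<odot>\<^bsub>M\<^esub> \<eta>)"
  by (simp_all add: semidirect_def)

lemma fst_semidirect_add: "fst (a \<oplus>\<^bsub>semidirect R A M\<^esub> b) = fst a \<oplus>\<^bsub>A\<^esub> fst b"
  by (cases a; cases b) simp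

lemma snd_semidirect_add: "snd (a \<oplus>\<^bsub>semidirect R A M\<^esub> b) = snd a \<oplus>\<^bsub>M\<^esub> snd b"
  by (cases a; cases b) simp

lemma (in abelian_group) minus_zero_eq [simp]: "\<ominus> \<zero> = \<zero>"
  using minus_equality[of \<zero> \<zero>] by simp

text \<open>A scalar \<open>r\<close> acts through \<open>r\<close> times the unit of
  \<open>M\<close>, so everything reduces to this assignment being compatible with sums, products
  and units; \<open>assoc\<close> is the case of products.\<close>

lemma (in algebra) module_restrict_scalars:
  assumes "module M N"
  shows "module R (restrict_scalars R M N)"
proof -
  interpret N: module M N by (rule assms)
  interpret M: cring M by (rule M_cring)
  have assoc: "(r \<otimes>\<^bsub>R\<^esub> s) \<odot>\<^bsub>M\<^esub> \<one>\<^bsub>M\<^esub> = (r \<odot>\<^bsub>M\<^esub> \<one>\<^bsub>M\<^esub>) \<otimes>\<^bsub>M\<^esub> (s \<odot>\<^bsub>M\<^esub> \<one>\<^bsub>M\<^esub>)"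
    if "r \<in> carrier R" "s \<in> carrier R" for r s
    using that by (simp add: smult_assoc2 smult_assoc1)
  have "abelian_monoid (restrict_scalars R M N)"
    by (rule abelian_monoidI) (simp_all add: N.M.a_ac)
  then have "abelian_group (restrict_scalars R M N)"
    by (intro abelian_groupI) (auto simp: N.M.a_ac intro: bexI[of _ "\<ominus>\<^bsub>N\<^esub> _"] N.M.l_neg)
  then show ?thesis
    by (intro moduleI R_cring)
      (simp_all add: smult_l_distr assoc N.smult_l_distr N.smult_r_distr N.smult_assoc1)
qed

section \<open>Poisson triples\<close>

context poisson_triple
begin

abbreviation S where "S \<equiv> semidirect R P0 P1"
abbreviation D where "D f \<equiv> \<D> (kaehler_d R P0 f)"
abbreviation K where "K f g \<equiv> \<K> (kaehler_d R P0 f) (kaehler_d R P0 g)"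

text \<open>A differential is by construction the coset of a generator, so it suffices that the
  generator, supported at \<open>f\<close> at most, belongs to the free module.\<close>

lemma kaehler_d_closed: "f \<in> carrier P0 \<Longrightarrow> kaehler_d R P0 f \<in> carrier (kaehler R P0)"
proof -
  assume f: "f \<in> carrier P0"
  have "finite {i. free_gen P0 f i \<noteq> \<zero>\<^bsub>P0\<^esub>}"
    by (rule finite_subset[of _ "{f}"]) (auto simp: free_gen_def)
  with f have "free_gen P0 f \<in> carrier (free_module P0 (carrier P0))"
    by (auto simp: free_module_def free_gen_def)
  then show ?thesis
    by (auto simp: kaehler_d_def kaehler_def quot_module_def A_RCOSETS_def')
qed

lemma D_closed [simp]: "\<lbrakk>f \<in> carrier P0; \<eta> \<in> carrier P1\<rbrakk> \<Longrightarrow> D f \<eta> \<in> carrier P1"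
  using contravariant kaehler_d_closed
  unfolding contravariant_derivative_def bilinear_map_def by simp

lemma D_add: "\<lbrakk>f \<in> carrier P0; \<eta> \<in> carrier P1; \<xi> \<in> carrier P1\<rbrakk> \<Longrightarrow> D f (\<eta> \<oplus>\<^bsub>P1\<^esub> \<xi>) = D f \<eta> \<oplus>\<^bsub>P1\<^esub> D f \<xi>"
  using contravariant kaehler_d_closed
  unfolding contravariant_derivative_def bilinear_map_def by simp

lemma K_closed [simp]: "\<lbrakk>f \<in> carrier P0; g \<in> carrier P0\<rbrakk> \<Longrightarrow> K f g \<in> carrier P1"
  using K_bilinear kaehler_d_closed unfolding bilinear_map_def by simp

lemma D_zero [simp]:
  assumes "f \<in> carrier P0"
  shows "D f \<zero>\<^bsub>P1\<^esub> = \<zero>\<^bsub>P1\<^esub>"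
  using D_add[OF assms P1.zero_closed P1.zero_closed] assms P1.add.r_cancel_one' by simp

lemma D_minus:
  assumes "f \<in> carrier P0" "\<eta> \<in> carrier P1"
  shows "D f (\<ominus>\<^bsub>P1\<^esub> \<eta>) = \<ominus>\<^bsub>P1\<^esub> D f \<eta>"
proof (rule P1.minus_equality[symmetric])
  show "D f (\<ominus>\<^bsub>P1\<^esub> \<eta>) \<oplus>\<^bsub>P1\<^esub> D f \<eta> = \<zero>\<^bsub>P1\<^esub>"
    using D_add[of f "\<ominus>\<^bsub>P1\<^esub> \<eta>" \<eta>] assms by (simp add: P1.l_neg)
qed (use assms in auto)

text \<open>The bracket with the zero element vanishes, and in \<open>bracket_eq\<close> for
  \<open>(f, 0)\<close> and zero all other terms of the second component vanish too, which isolates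
  this value. The value of \<open>D\<close> at zero is found below in the same way.\<close>

lemma K_zero_right [simp]: "f \<in> carrier P0 \<Longrightarrow> K f \<zero>\<^bsub>P0\<^esub> = \<zero>\<^bsub>P1\<^esub>"
  using bracket_eq[of f "\<zero>\<^bsub>P1\<^esub>" "\<zero>\<^bsub>P0\<^esub>" "\<zero>\<^bsub>P1\<^esub>"] P.br_zero_right[of "(f, \<zero>\<^bsub>P1\<^esub>)"]
  by (simp add: a_minus_def)

lemma K_zero_left [simp]: "f \<in> carrier P0 \<Longrightarrow> K \<zero>\<^bsub>P0\<^esub> f = \<zero>\<^bsub>P1\<^esub>"
  using K_skew[of "kaehler_d R P0 \<zero>\<^bsub>P0\<^esub>" "kaehler_d R P0 f"] kaehler_d_closed by simp

lemma D_zero_left [simp]: "\<eta> \<in> carrier P1 \<Longrightarrow> D \<zero>\<^bsub>P0\<^esub> \<eta> = \<zero>\<^bsub>P1\<^esub>"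
  using bracket_eq[of "\<zero>\<^bsub>P0\<^esub>" "\<zero>\<^bsub>P1\<^esub>" "\<zero>\<^bsub>P0\<^esub>" \<eta>] P.br_zero_left[of "(\<zero>\<^bsub>P0\<^esub>, \<eta>)"]
  by (simp add: a_minus_def)

text \<open>This and the next three cases single out the ingredients of the triple. Evaluating a
  derivation rule on such pairs turns it into separate conditions on \<open>K\<close>,
  \<open>D\<close> and \<open>br1\<close>.\<close>

lemma br_base_base: "\<lbrakk>f \<in> carrier P0; g \<in> carrier P0\<rbrakk> \<Longrightarrow> br (f, \<zero>\<^bsub>P1\<^esub>) (g, \<zero>\<^bsub>P1\<^esub>) = (br0 f g, K f g)"
  by (simp add: bracket_eq a_minus_def)

lemma br_base_fibre:
  "\<lbrakk>f \<in> carrier P0; \<xi> \<in> carrier P1\<rbrakk> \<Longrightarrow> br (f, \<zero>\<^bsub>P1\<^esub>) (\<zero>\<^bsub>P0\<^esub>, \<xi>) = (\<zero>\<^bsub>P0\<^esub>, D f \<xi>)"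
  by (simp add: bracket_eq a_minus_def)

lemma br_fibre_base:
  "\<lbrakk>\<eta> \<in> carrier P1; g \<in> carrier P0\<rbrakk> \<Longrightarrow> br (\<zero>\<^bsub>P0\<^esub>, \<eta>) (g, \<zero>\<^bsub>P1\<^esub>) = (\<zero>\<^bsub>P0\<^esub>, \<ominus>\<^bsub>P1\<^esub> D g \<eta>)"
  by (simp add: bracket_eq a_minus_def)

lemma br_fibre_fibre:
  "\<lbrakk>\<eta> \<in> carrier P1; \<xi> \<in> carrier P1\<rbrakk> \<Longrightarrow> br (\<zero>\<^bsub>P0\<^esub>, \<eta>) (\<zero>\<^bsub>P0\<^esub>, \<xi>) = (\<zero>\<^bsub>P0\<^esub>, br1 \<eta> \<xi>)"
  by (simp add: bracket_eq a_minus_def)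

lemma module_P1: "module R (restrict_scalars R P0 P1)"
  by (rule P0.module_restrict_scalars[OF P1.module_axioms])

section \<open>Vertical Poisson derivations\<close>

text \<open>In the application of \<open>isomorphic_quotI\<close> this set is the submodule
  \<open>N\<close>, and \<open>vpart\<close> below is the map \<open>\<Psi>\<close>.\<close>

definition vertical :: "('a \<times> 'b \<Rightarrow> 'a \<times> 'b) set"
  where "vertical = {X \<in> Poiss R S br. \<forall>a \<in> carrier S. fst (X a) = \<zero>\<^bsub>P0\<^esub>}"

definition vpart :: "('a \<times> 'b \<Rightarrow> 'a \<times> 'b) \<Rightarrow> 'b \<Rightarrow> 'b"
  where "vpart X = (\<lambda>\<eta> \<in> carrier P1. snd (X (\<zero>\<^bsub>P0\<^esub>, \<eta>)))"

lemma Poiss_closed: "\<lbrakk>X \<in> Poiss R S br; a \<in> carrier S\<rbrakk> \<Longrightarrow> X a \<in> carrier S"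
  using linear_maps_closed[OF Poiss_linear] by metis

lemma Poiss_fst_closed: "\<lbrakk>X \<in> Poiss R S br; a \<in> carrier S\<rbrakk> \<Longrightarrow> fst (X a) \<in> carrier P0"
  using Poiss_closed[of X a] by (cases "X a") simp

lemma Poiss_snd_closed: "\<lbrakk>X \<in> Poiss R S br; a \<in> carrier S\<rbrakk> \<Longrightarrow> snd (X a) \<in> carrier P1"
  using Poiss_closed[of X a] by (cases "X a") simp

text \<open>By additivity a derivation is known once it is known on base elements and on fibre
  elements separately.\<close>

lemma Poiss_split:
  assumes "X \<in> Poiss R S br" "f \<in> carrier P0" "\<eta> \<in> carrier P1"
  shows "X (f, \<eta>) = X (f, \<zero>\<^bsub>P1\<^esub>) \<oplus>\<^bsub>S\<^esub> X (\<zero>\<^bsub>P0\<^esub>, \<eta>)"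
  using linear_maps_add[OF Poiss_linear[OF assms(1)], of "(f, \<zero>\<^bsub>P1\<^esub>)" "(\<zero>\<^bsub>P0\<^esub>, \<eta>)"] assms by simp

lemma submodule_vertical: "submodule vertical R (map_module S)"
proof -
  interpret F: module R "map_module S" by (rule module_map_module[OF P.module])
  note Poiss = P.submodule_Poiss
  have car: "X \<in> carrier (map_module S)" if "X \<in> Poiss R S br" for X
    using F.submoduleE(1)[OF Poiss] that by blast
  have sm: "r \<odot>\<^bsub>map_module S\<^esub> X \<in> vertical" if r: "r \<in> carrier R" and X: "X \<in> vertical" for r X
  proof -
    have XP: "X \<in> Poiss R S br" and X0: "\<And>a. a \<in> carrier S \<Longrightarrow> fst (X a) = \<zero>\<^bsub>P0\<^esub>"
      using X unfolding vertical_def by auto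
    have "fst ((r \<odot>\<^bsub>map_module S\<^esub> X) a) = \<zero>\<^bsub>P0\<^esub>" if "a \<in> carrier S" for a
      using that X0[OF that] r by (cases "X a") (simp del: semidirect_simps(1))
    then show ?thesis using F.submoduleE(4)[OF Poiss r XP] unfolding vertical_def by blast
  qed
  show ?thesis
  proof (rule F.submoduleI)
    show "vertical \<subseteq> carrier (map_module S)" using car unfolding vertical_def by blast
    show "\<zero>\<^bsub>map_module S\<^esub> \<in> vertical"
      using submodule.axioms(1)[OF Poiss, THEN subgroup.one_closed] by (auto simp: vertical_def)
    show "r \<odot>\<^bsub>map_module S\<^esub> X \<in> vertical" if "r \<in> carrier R" "X \<in> vertical" for r X
      using that by (rule sm)
    show "\<ominus>\<^bsub>map_module S\<^esub> X \<in> vertical" if X: "X \<in> vertical" for X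
    proof -
      have "\<ominus>\<^bsub>map_module S\<^esub> X = (\<ominus>\<^bsub>R\<^esub> \<one>\<^bsub>R\<^esub>) \<odot>\<^bsub>map_module S\<^esub> X"
        using car[of X] X F.smult_l_minus[of "\<one>\<^bsub>R\<^esub>" X]
        by (simp del: map_module_simps add: F.smult_one vertical_def)
      then show ?thesis using sm[OF _ X] P0.R.one_closed P0.R.a_inv_closed by metis
    qed
    show "X \<oplus>\<^bsub>map_module S\<^esub> Y \<in> vertical" if X: "X \<in> vertical" and Y: "Y \<in> vertical" for X Y
    proof -
      have "fst ((X \<oplus>\<^bsub>map_module S\<^esub> Y) a) = \<zero>\<^bsub>P0\<^esub>" if "a \<in> carrier S" for a
        using X Y that P0.M.r_zero[OF P0.M.zero_closed]
        by (simp add: vertical_def fst_semidirect_add del: semidirect_simps(1))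
      then show ?thesis
        using F.submoduleE(5)[OF Poiss] X Y unfolding vertical_def by blast
    qed
  qed
qed

lemma vpart_closed: "X \<in> carrier (map_module S) \<Longrightarrow> vpart X \<in> carrier (map_module (restrict_scalars R P0 P1))"
proof -
  assume X: "X \<in> carrier (map_module S)"
  have "snd (X (\<zero>\<^bsub>P0\<^esub>, \<eta>)) \<in> carrier P1" if "\<eta> \<in> carrier P1" for \<eta>
  proof -
    have "X (\<zero>\<^bsub>P0\<^esub>, \<eta>) \<in> carrier S"
      by (rule PiE_mem[of X "carrier S" "\<lambda>_. carrier S"]) (use X that in simp_all)
    then show ?thesis by (simp add: mem_Times_iff)
  qed
  then show ?thesis by (simp add: vpart_def)
qed

lemma vpart_add:
  "vpart (X \<oplus>\<^bsub>map_module S\<^esub> Y) = vpart X \<oplus>\<^bsub>map_module (restrict_scalars R P0 P1)\<^esub> vpart Y"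
  by (simp add: vpart_def snd_semidirect_add cong: restrict_cong)

lemma vpart_smult:
  "vpart (r \<odot>\<^bsub>map_module S\<^esub> X) = r \<odot>\<^bsub>map_module (restrict_scalars R P0 P1)\<^esub> vpart X"
proof -
  have "snd (r \<odot>\<^bsub>S\<^esub> a) = (r \<odot>\<^bsub>P0\<^esub> \<one>\<^bsub>P0\<^esub>) \<odot>\<^bsub>P1\<^esub> snd a" for a by (cases a) simp
  then show ?thesis by (simp add: vpart_def cong: restrict_cong)
qed

section \<open>Splitting off a Hamiltonian derivation\<close>

text \<open>The base component of \<open>X\<close> on the fibre is \<open>P0\<close>-linear and kills brackets.\<close>

lemma Poiss_fst_fibre:
  assumes X: "X \<in> Poiss R S br" and perfect: "perfect_lie P0 P1 br1" and \<eta>: "\<eta> \<in> carrier P1"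
  shows "fst (X (\<zero>\<^bsub>P0\<^esub>, \<eta>)) = \<zero>\<^bsub>P0\<^esub>"
proof -
  let ?N = "{\<eta> \<in> carrier P1. fst (X (\<zero>\<^bsub>P0\<^esub>, \<eta>)) = \<zero>\<^bsub>P0\<^esub>}"
  \<comment> \<open>\<open>(0, f \<xi>)\<close> is the product of \<open>(f, 0)\<close> and
    \<open>(0, \<xi>)\<close>. In the Leibniz rule both summands have a factor with zero base
    component, because \<open>X (0, \<xi>)\<close> and \<open>(0, \<xi>)\<close> do.\<close>
  have sm: "f \<odot>\<^bsub>P1\<^esub> \<xi> \<in> ?N" if f: "f \<in> carrier P0" and \<xi>: "\<xi> \<in> ?N" for f \<xi>
  proof -
    obtain \<zeta> where \<zeta>: "X (\<zero>\<^bsub>P0\<^esub>, \<xi>) = (\<zero>\<^bsub>P0\<^esub>, \<zeta>)" using \<xi> by (cases "X (\<zero>\<^bsub>P0\<^esub>, \<xi>)") auto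
    obtain g \<rho> where g: "X (f, \<zero>\<^bsub>P1\<^esub>) = (g, \<rho>)" by (cases "X (f, \<zero>\<^bsub>P1\<^esub>)")
    have "g \<in> carrier P0" using Poiss_fst_closed[OF X, of "(f, \<zero>\<^bsub>P1\<^esub>)"] f g by simp
    then show ?thesis
      using Poiss_mult[OF X, of "(f, \<zero>\<^bsub>P1\<^esub>)" "(\<zero>\<^bsub>P0\<^esub>, \<xi>)"] f \<xi> \<zeta> g by simp
  qed
  have "submodule ?N P0 P1"
  proof (rule P1.submoduleI)
    show "\<zero>\<^bsub>P1\<^esub> \<in> ?N"
      using P.linear_maps_zero[OF Poiss_linear[OF X] P.module] by simp
    show "\<xi> \<oplus>\<^bsub>P1\<^esub> \<zeta> \<in> ?N" if "\<xi> \<in> ?N" "\<zeta> \<in> ?N" for \<xi> \<zeta>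
      using that linear_maps_add[OF Poiss_linear[OF X], of "(\<zero>\<^bsub>P0\<^esub>, \<xi>)" "(\<zero>\<^bsub>P0\<^esub>, \<zeta>)"]
      by (simp add: fst_semidirect_add)
    show "\<ominus>\<^bsub>P1\<^esub> \<xi> \<in> ?N" if "\<xi> \<in> ?N" for \<xi>
      using sm[OF _ that, of "\<ominus>\<^bsub>P0\<^esub> \<one>\<^bsub>P0\<^esub>"] that P1.smult_l_minus[of "\<one>\<^bsub>P0\<^esub>" \<xi>] by simp
  qed (use sm in auto)
  \<comment> \<open>For arbitrary fibre elements, the base component of the derivation rule is
    \<open>br0 g 0\<close> plus \<open>br0 0 h\<close>, which vanishes.\<close>
  moreover have "br1 \<xi> \<zeta> \<in> ?N" if "\<xi> \<in> carrier P1" "\<zeta> \<in> carrier P1" for \<xi> \<zeta>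
  proof -
    obtain g \<rho> where g: "X (\<zero>\<^bsub>P0\<^esub>, \<xi>) = (g, \<rho>)" by (cases "X (\<zero>\<^bsub>P0\<^esub>, \<xi>)")
    obtain h \<sigma> where h: "X (\<zero>\<^bsub>P0\<^esub>, \<zeta>) = (h, \<sigma>)" by (cases "X (\<zero>\<^bsub>P0\<^esub>, \<zeta>)")
    have "g \<in> carrier P0" "\<rho> \<in> carrier P1" "h \<in> carrier P0" "\<sigma> \<in> carrier P1"
      using Poiss_closed[OF X, of "(\<zero>\<^bsub>P0\<^esub>, \<xi>)"] Poiss_closed[OF X, of "(\<zero>\<^bsub>P0\<^esub>, \<zeta>)"] that g h by auto
    then show ?thesis
      using Poiss_br[OF X, of "(\<zero>\<^bsub>P0\<^esub>, \<xi>)" "(\<zero>\<^bsub>P0\<^esub>, \<zeta>)"] that g h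
      by (simp add: br_fibre_fibre fst_semidirect_add admissible)
  qed
  \<comment> \<open>\<open>?N\<close> is one of the submodules in the intersection; perfectness says
    that this intersection is all of \<open>P1\<close>.\<close>
  ultimately have "generated_submodule P0 P1 {br1 x y | x y. x \<in> carrier P1 \<and> y \<in> carrier P1} \<subseteq> ?N"
    unfolding generated_submodule_def by blast
  then show ?thesis using perfect \<eta> unfolding perfect_lie_def by blast
qed

text \<open>The base component of \<open>X\<close> descends to \<open>P0\<close> because
  \<open>X\<close> preserves the fibre; the rules for \<open>P0\<close> are then the base components
  of the rules for \<open>X\<close>.\<close>

lemma Poiss_base:
  assumes X: "X \<in> Poiss R S br" and perfect: "perfect_lie P0 P1 br1"
  shows "(\<lambda>f \<in> carrier P0. fst (X (f, \<zero>\<^bsub>P1\<^esub>))) \<in> Poiss R P0 br0"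
proof (rule PoissI, rule linear_mapsI)
  let ?X = "\<lambda>f \<in> carrier P0. fst (X (f, \<zero>\<^bsub>P1\<^esub>))"
  fix f assume f: "f \<in> carrier P0"
  show cl: "?X f \<in> carrier P0" using f Poiss_fst_closed[OF X] by simp
  obtain f' \<eta> where f': "X (f, \<zero>\<^bsub>P1\<^esub>) = (f', \<eta>)" by (cases "X (f, \<zero>\<^bsub>P1\<^esub>)")
  show "?X (r \<odot>\<^bsub>P0\<^esub> f) = r \<odot>\<^bsub>P0\<^esub> ?X f" if "r \<in> carrier R" for r
    using linear_maps_smult[OF Poiss_linear[OF X], of r "(f, \<zero>\<^bsub>P1\<^esub>)"] f f' that by simp
  fix g assume g: "g \<in> carrier P0"
  obtain g' \<xi> where g': "X (g, \<zero>\<^bsub>P1\<^esub>) = (g', \<xi>)" by (cases "X (g, \<zero>\<^bsub>P1\<^esub>)")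
  have cls: "f' \<in> carrier P0" "\<eta> \<in> carrier P1" "g' \<in> carrier P0" "\<xi> \<in> carrier P1"
    using Poiss_closed[OF X, of "(f, \<zero>\<^bsub>P1\<^esub>)"] Poiss_closed[OF X, of "(g, \<zero>\<^bsub>P1\<^esub>)"] f g f' g' by auto
  show "?X (f \<oplus>\<^bsub>P0\<^esub> g) = ?X f \<oplus>\<^bsub>P0\<^esub> ?X g"
    using linear_maps_add[OF Poiss_linear[OF X], of "(f, \<zero>\<^bsub>P1\<^esub>)" "(g, \<zero>\<^bsub>P1\<^esub>)"] f g f' g' by simp
  show "?X (f \<otimes>\<^bsub>P0\<^esub> g) = f \<otimes>\<^bsub>P0\<^esub> ?X g \<oplus>\<^bsub>P0\<^esub> g \<otimes>\<^bsub>P0\<^esub> ?X f"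
    using Poiss_mult[OF X, of "(f, \<zero>\<^bsub>P1\<^esub>)" "(g, \<zero>\<^bsub>P1\<^esub>)"] f g f' g' by simp
  \<comment> \<open>The bracket of two base elements has the fibre component \<open>K f g\<close>.
    By \<open>Poiss_fst_fibre\<close> it does not affect the base component of the value of
    \<open>X\<close>.\<close>
  have "fst (X (br0 f g, K f g)) = fst (X (br0 f g, \<zero>\<^bsub>P1\<^esub>))"
    using Poiss_split[OF X, of "br0 f g" "K f g"] f g Poiss_fst_fibre[OF X perfect]
      Poiss_fst_closed[OF X, of "(br0 f g, \<zero>\<^bsub>P1\<^esub>)"]
    by (simp add: fst_semidirect_add)
  then show "?X (br0 f g) = br0 (?X f) g \<oplus>\<^bsub>P0\<^esub> br0 f (?X g)"
    using Poiss_br[OF X, of "(f, \<zero>\<^bsub>P1\<^esub>)" "(g, \<zero>\<^bsub>P1\<^esub>)"] f g f' g' cls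
    by (simp add: br_base_base fst_semidirect_add admissible)
qed simp

text \<open>The potential \<open>h\<close> of the base derivation is lifted to
  \<open>(h, 0)\<close>. Admissibility gives the Hamiltonian derivation of this lift the same base
  component as \<open>X\<close>, so the difference is vertical.\<close>

lemma Poiss_decomp:
  assumes X: "X \<in> Poiss R S br" and perfect: "perfect_lie P0 P1 br1"
    and P0: "Poiss R P0 br0 \<subseteq> Ham P0 br0"
  shows "\<exists>Z \<in> Ham S br. \<exists>Y \<in> vertical. X = Z \<oplus>\<^bsub>map_module S\<^esub> Y"
proof -
  interpret F: module R "map_module S" by (rule module_map_module[OF P.module])
  obtain h where h: "h \<in> carrier P0"
    and eq: "(\<lambda>f \<in> carrier P0. fst (X (f, \<zero>\<^bsub>P1\<^esub>))) = (\<lambda>f \<in> carrier P0. br0 h f)"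
    using Poiss_base[OF X perfect] P0 unfolding Ham_def by blast
  have X0: "fst (X (f, \<zero>\<^bsub>P1\<^esub>)) = br0 h f" if "f \<in> carrier P0" for f
    using fun_cong[OF eq, of f] that by simp
  define Z where "Z = (\<lambda>a \<in> carrier S. br (h, \<zero>\<^bsub>P1\<^esub>) a)"
  define Y where "Y = \<ominus>\<^bsub>map_module S\<^esub> Z \<oplus>\<^bsub>map_module S\<^esub> X"
  have Z: "Z \<in> Ham S br" using h unfolding Ham_def Z_def by auto
  then have ZP: "Z \<in> Poiss R S br" using P.Ham_subset_Poiss by blast
  have Y: "Y \<in> Poiss R S br"
    unfolding Y_def using F.submoduleE(3,5)[OF P.submodule_Poiss] X ZP by blast
  have car: "Z \<in> carrier (map_module S)" "X \<in> carrier (map_module S)" "Y \<in> carrier (map_module S)"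
    using ZP X Y F.submoduleE(1)[OF P.submodule_Poiss] by blast+
  then have XYZ: "X = Z \<oplus>\<^bsub>map_module S\<^esub> Y"
    unfolding Y_def by (metis F.M.a_inv_closed F.M.a_assoc F.M.r_neg F.M.l_zero)
  have "fst (Y (f, \<eta>)) = \<zero>\<^bsub>P0\<^esub>" if f: "f \<in> carrier P0" and \<eta>: "\<eta> \<in> carrier P1" for f \<eta>
  proof -
    have "fst (X (f, \<eta>)) = fst (Z (f, \<eta>)) \<oplus>\<^bsub>P0\<^esub> fst (Y (f, \<eta>))"
      using f \<eta> by (subst XYZ) (simp add: fst_semidirect_add)
    moreover have "fst (Z (f, \<eta>)) = br0 h f" using h f \<eta> by (simp add: Z_def admissible)
    moreover have "fst (X (f, \<eta>)) = br0 h f"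
      using Poiss_split[OF X f \<eta>] Poiss_fst_fibre[OF X perfect \<eta>] X0[OF f] h f
      by (simp add: fst_semidirect_add)
    moreover have "fst (Y (f, \<eta>)) \<in> carrier P0" using Poiss_fst_closed[OF Y] f \<eta> by simp
    ultimately show ?thesis using h f P0.M.add.r_cancel_one' by simp
  qed
  then have "Y \<in> vertical" using Y unfolding vertical_def by auto
  then show ?thesis using Z XYZ by blast
qed

section \<open>Vertical derivations and their restrictions to the fibre\<close>

lemma vertical_fibre:
  assumes "X \<in> vertical" "\<eta> \<in> carrier P1"
  shows "X (\<zero>\<^bsub>P0\<^esub>, \<eta>) = (\<zero>\<^bsub>P0\<^esub>, vpart X \<eta>)"
  using assms by (auto simp: vertical_def vpart_def prod_eq_iff)

lemma vertical_base:
  assumes "X \<in> vertical" "f \<in> carrier P0"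
  shows "X (f, \<zero>\<^bsub>P1\<^esub>) = (\<zero>\<^bsub>P0\<^esub>, snd (X (f, \<zero>\<^bsub>P1\<^esub>)))"
  using assms by (auto simp: vertical_def prod_eq_iff)

text \<open>The kernel condition for \<open>isomorphic_quotI\<close>: what remains of
  \<open>X\<close> is its value \<open>\<theta>\<close> on a base element, and
  \<open>\<theta>\<close> turns out to be central.\<close>

lemma vertical_vpart_zero:
  assumes centerless: "centerless_lie P1 br1" and X: "X \<in> vertical"
    and zero: "\<And>\<eta>. \<eta> \<in> carrier P1 \<Longrightarrow> vpart X \<eta> = \<zero>\<^bsub>P1\<^esub>"
  shows "X = \<zero>\<^bsub>map_module S\<^esub>"
proof
  have XP: "X \<in> Poiss R S br" using X unfolding vertical_def by blast
  fix a
  show "X a = \<zero>\<^bsub>map_module S\<^esub> a"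
  proof (cases "a \<in> carrier S")
    case False
    then show ?thesis using linear_maps_undefined[OF Poiss_linear[OF XP]] by simp
  next
    case True
    then obtain f \<eta> where a: "a = (f, \<eta>)" "f \<in> carrier P0" "\<eta> \<in> carrier P1" by auto
    define \<theta> where "\<theta> = snd (X (f, \<zero>\<^bsub>P1\<^esub>))"
    have \<theta>: "X (f, \<zero>\<^bsub>P1\<^esub>) = (\<zero>\<^bsub>P0\<^esub>, \<theta>)" using vertical_base[OF X a(2)] by (simp add: \<theta>_def)
    have \<theta>_cl: "\<theta> \<in> carrier P1" using Poiss_snd_closed[OF XP] a unfolding \<theta>_def by simp
    \<comment> \<open>Apply \<open>X\<close> to the bracket of \<open>(f, 0)\<close> and
      \<open>(0, \<xi>)\<close>, which lies in the fibre. Every term containing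
      \<open>vpart X\<close> is zero, and only the bracket of \<open>\<theta>\<close> with
      \<open>\<xi>\<close> is left.\<close>
    have "br1 \<theta> \<xi> = \<zero>\<^bsub>P1\<^esub>" if \<xi>: "\<xi> \<in> carrier P1" for \<xi>
      using Poiss_br[OF XP, of "(f, \<zero>\<^bsub>P1\<^esub>)" "(\<zero>\<^bsub>P0\<^esub>, \<xi>)"] a \<xi> \<theta>_cl
      by (simp add: br_base_fibre br_fibre_fibre vertical_fibre[OF X] zero \<theta>)
    then have "\<theta> = \<zero>\<^bsub>P1\<^esub>" using centerless \<theta>_cl unfolding centerless_lie_def by blast
    then show ?thesis
      using Poiss_split[OF XP a(2,3)] a by (simp add: vertical_fibre[OF X] zero \<theta>)
  qed
qed

text \<open>The Hamiltonian derivation of \<open>(k, \<eta>)\<close> has base component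
  \<open>br0 k\<close>, so it is vertical exactly for a Casimir \<open>k\<close>. Its restriction is
  a sum of one term from each summand on the right.\<close>

lemma vpart_vertical_Ham:
  "vpart ` (vertical \<inter> Ham S br) = C_zero R P0 br0 P1 \<D> <+>\<^bsub>map_module (restrict_scalars R P0 P1)\<^esub> Inn P1 br1"
    (is "_ = ?Q")
proof -
  have eq: "vpart (\<lambda>a \<in> carrier S. br (k, \<eta>) a) = (\<lambda>\<xi> \<in> carrier P1. D k \<xi> \<oplus>\<^bsub>P1\<^esub> br1 \<eta> \<xi>)"
    if "k \<in> carrier P0" "\<eta> \<in> carrier P1" for k \<eta>
    using that by (simp add: vpart_def bracket_eq a_minus_def cong: restrict_cong)
  have ver: "(\<lambda>a \<in> carrier S. br (k, \<eta>) a) \<in> vertical \<inter> Ham S br \<longleftrightarrow> k \<in> Casim P0 br0"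
    if "k \<in> carrier P0" "\<eta> \<in> carrier P1" for k \<eta>
  proof -
    have "(\<lambda>a \<in> carrier S. br (k, \<eta>) a) \<in> Ham S br" using that unfolding Ham_def by auto
    moreover from this have "(\<lambda>a \<in> carrier S. br (k, \<eta>) a) \<in> Poiss R S br" using P.Ham_subset_Poiss by blast
    \<comment> \<open>A witness that \<open>P1\<close> is nonempty, so that every \<open>f\<close>
      in \<open>P0\<close> occurs as the base component of an element of \<open>S\<close>.\<close>
    moreover have "\<zero>\<^bsub>P1\<^esub> \<in> carrier P1" by simp
    ultimately show ?thesis using that
      unfolding vertical_def Casim_def by (auto simp: admissible)
  qed
  have Q: "?Q = {\<lambda>\<xi> \<in> carrier P1. D k \<xi> \<oplus>\<^bsub>P1\<^esub> br1 \<eta> \<xi> | k \<eta>. k \<in> Casim P0 br0 \<and> \<eta> \<in> carrier P1}"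
  proof -
    have "(\<lambda>\<xi> \<in> carrier P1. D k \<xi>) \<oplus>\<^bsub>map_module (restrict_scalars R P0 P1)\<^esub> ad P1 br1 \<eta>
        = (\<lambda>\<xi> \<in> carrier P1. D k \<xi> \<oplus>\<^bsub>P1\<^esub> br1 \<eta> \<xi>)" for k \<eta>
      by (simp add: ad_def cong: restrict_cong)
    moreover have "?Q = {(\<lambda>\<xi> \<in> carrier P1. D k \<xi>) \<oplus>\<^bsub>map_module (restrict_scalars R P0 P1)\<^esub> ad P1 br1 \<eta>
        | k \<eta>. k \<in> Casim P0 br0 \<and> \<eta> \<in> carrier P1}"
      unfolding set_add_def' C_zero_def Inn_def by blast
    ultimately show ?thesis by (simp only:)
  qed
  show ?thesis
  proof
    show "vpart ` (vertical \<inter> Ham S br) \<subseteq> ?Q"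
    proof
      fix L assume "L \<in> vpart ` (vertical \<inter> Ham S br)"
      then obtain X where X: "X \<in> vertical \<inter> Ham S br" "L = vpart X" by blast
      then obtain k \<eta> where "k \<in> carrier P0" "\<eta> \<in> carrier P1" "X = (\<lambda>a \<in> carrier S. br (k, \<eta>) a)"
        by (auto simp: Ham_def)
      then show "L \<in> ?Q" unfolding Q using X eq ver by blast
    qed
    show "?Q \<subseteq> vpart ` (vertical \<inter> Ham S br)"
    proof
      fix L assume "L \<in> ?Q"
      then obtain k \<eta> where k: "k \<in> Casim P0 br0" "\<eta> \<in> carrier P1"
        "L = (\<lambda>\<xi> \<in> carrier P1. D k \<xi> \<oplus>\<^bsub>P1\<^esub> br1 \<eta> \<xi>)"
        unfolding Q by blast
      then have kP0: "k \<in> carrier P0" by (simp add: Casim_def)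
      have "L = vpart (\<lambda>a \<in> carrier S. br (k, \<eta>) a)"
        "(\<lambda>a \<in> carrier S. br (k, \<eta>) a) \<in> vertical \<inter> Ham S br"
        using k(1,3) eq[OF kP0 k(2)] ver[OF kP0 k(2)] by (simp_all only:)
      then show "L \<in> vpart ` (vertical \<inter> Ham S br)" by (rule image_eqI)
    qed
  qed
qed

text \<open>The bracket rule for \<open>X\<close> on two fibre elements, on a base and a fibre
  element, and on two base elements gives, in this order, the derivation property, the commutator
  condition and the condition on \<open>\<K>\<close>.\<close>

lemma vpart_mem_M_zero:
  assumes X: "X \<in> vertical"
  shows "vpart X \<in> M_zero R P0 br0 P1 br1 \<D> \<K>"
proof -
  have XP: "X \<in> Poiss R S br" using X unfolding vertical_def by blast
  define L where "L = vpart X"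
  define \<theta> where "\<theta> f = snd (X (f, \<zero>\<^bsub>P1\<^esub>))" for f
  have L: "X (\<zero>\<^bsub>P0\<^esub>, \<eta>) = (\<zero>\<^bsub>P0\<^esub>, L \<eta>)" if "\<eta> \<in> carrier P1" for \<eta>
    using vertical_fibre[OF X that] by (simp add: L_def)
  have \<theta>: "X (f, \<zero>\<^bsub>P1\<^esub>) = (\<zero>\<^bsub>P0\<^esub>, \<theta> f)" if "f \<in> carrier P0" for f
    using vertical_base[OF X that] by (simp add: \<theta>_def)
  have L_cl [simp]: "L \<eta> \<in> carrier P1" if "\<eta> \<in> carrier P1" for \<eta>
    using Poiss_closed[OF XP, of "(\<zero>\<^bsub>P0\<^esub>, \<eta>)"] L that by simp
  have \<theta>_cl [simp]: "\<theta> f \<in> carrier P1" if "f \<in> carrier P0" for f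
    using Poiss_closed[OF XP, of "(f, \<zero>\<^bsub>P1\<^esub>)"] \<theta> that by simp
  have split: "X (f, \<eta>) = (\<zero>\<^bsub>P0\<^esub>, \<theta> f \<oplus>\<^bsub>P1\<^esub> L \<eta>)" if "f \<in> carrier P0" "\<eta> \<in> carrier P1" for f \<eta>
    using Poiss_split[OF XP that] that by (simp add: L \<theta>)
  have "L \<in> linear_maps P0 P1 P1"
  proof (rule linear_mapsI)
    fix \<eta> assume \<eta>: "\<eta> \<in> carrier P1"
    show "L (\<eta> \<oplus>\<^bsub>P1\<^esub> \<xi>) = L \<eta> \<oplus>\<^bsub>P1\<^esub> L \<xi>" if \<xi>: "\<xi> \<in> carrier P1" for \<xi>
      using linear_maps_add[OF Poiss_linear[OF XP], of "(\<zero>\<^bsub>P0\<^esub>, \<eta>)" "(\<zero>\<^bsub>P0\<^esub>, \<xi>)"] \<eta> \<xi>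
      by (simp add: L)
    \<comment> \<open>In the Leibniz rule for \<open>(f, 0)\<close> and \<open>(0, \<eta>)\<close>
      the term with \<open>\<theta> f\<close> drops out, since two fibre elements have product
      zero.\<close>
    show "L (f \<odot>\<^bsub>P1\<^esub> \<eta>) = f \<odot>\<^bsub>P1\<^esub> L \<eta>" if f: "f \<in> carrier P0" for f
      using Poiss_mult[OF XP, of "(f, \<zero>\<^bsub>P1\<^esub>)" "(\<zero>\<^bsub>P0\<^esub>, \<eta>)"] \<eta> f by (simp add: L \<theta>)
  qed (use L_cl in \<open>simp_all add: L_def vpart_def\<close>)
  moreover have "L (br1 \<eta> \<xi>) = br1 (L \<eta>) \<xi> \<oplus>\<^bsub>P1\<^esub> br1 \<eta> (L \<xi>)"
    if "\<eta> \<in> carrier P1" "\<xi> \<in> carrier P1" for \<eta> \<xi>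
    using Poiss_br[OF XP, of "(\<zero>\<^bsub>P0\<^esub>, \<eta>)" "(\<zero>\<^bsub>P0\<^esub>, \<xi>)"] that by (simp add: L br_fibre_fibre)
  \<comment> \<open>The sign is forced: the bracket rule yields \<open>L\<close> after
    \<open>D f\<close> minus \<open>D f\<close> after \<open>L\<close>, whereas the commutator in
    \<open>M_zero\<close> has the opposite order.\<close>
  moreover define \<theta>' where "\<theta>' = (\<lambda>f \<in> carrier P0. \<ominus>\<^bsub>P1\<^esub> \<theta> f)"
  have "\<theta>' \<in> Der R P0 P1"
  proof -
    have "\<theta>' \<in> linear_maps R P0 (restrict_scalars R P0 P1)"
    proof (rule linear_mapsI)
      fix f assume f: "f \<in> carrier P0"
      show "\<theta>' (f \<oplus>\<^bsub>P0\<^esub> g) = \<theta>' f \<oplus>\<^bsub>restrict_scalars R P0 P1\<^esub> \<theta>' g" if g: "g \<in> carrier P0" for g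
        using linear_maps_add[OF Poiss_linear[OF XP], of "(f, \<zero>\<^bsub>P1\<^esub>)" "(g, \<zero>\<^bsub>P1\<^esub>)"] f g
        by (simp add: \<theta> \<theta>'_def P1.minus_add)
      show "\<theta>' (r \<odot>\<^bsub>P0\<^esub> f) = r \<odot>\<^bsub>restrict_scalars R P0 P1\<^esub> \<theta>' f" if r: "r \<in> carrier R" for r
        using linear_maps_smult[OF Poiss_linear[OF XP], of r "(f, \<zero>\<^bsub>P1\<^esub>)"] f r
        by (simp add: \<theta> \<theta>'_def P1.smult_r_minus)
    qed (simp_all add: \<theta>'_def)
    moreover have "\<theta>' (f \<otimes>\<^bsub>P0\<^esub> g) = f \<odot>\<^bsub>P1\<^esub> \<theta>' g \<oplus>\<^bsub>P1\<^esub> g \<odot>\<^bsub>P1\<^esub> \<theta>' f"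
      if "f \<in> carrier P0" "g \<in> carrier P0" for f g
      using Poiss_mult[OF XP, of "(f, \<zero>\<^bsub>P1\<^esub>)" "(g, \<zero>\<^bsub>P1\<^esub>)"] that
      by (simp add: \<theta> \<theta>'_def P1.minus_add P1.smult_r_minus)
    ultimately show ?thesis unfolding Der_def by blast
  qed
  moreover have "commutator P1 (D f) L = ad P1 br1 (\<theta>' f)" if f: "f \<in> carrier P0" for f
    unfolding commutator_def ad_def
  proof (rule restrict_ext)
    fix \<eta> assume \<eta>: "\<eta> \<in> carrier P1"
    have "L (D f \<eta>) = br1 (\<theta> f) \<eta> \<oplus>\<^bsub>P1\<^esub> D f (L \<eta>)"
      using Poiss_br[OF XP, of "(f, \<zero>\<^bsub>P1\<^esub>)" "(\<zero>\<^bsub>P0\<^esub>, \<eta>)"] f \<eta>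
      by (simp add: L \<theta> br_fibre_fibre br_base_fibre)
    then have "D f (L \<eta>) \<ominus>\<^bsub>P1\<^esub> L (D f \<eta>)
        = D f (L \<eta>) \<oplus>\<^bsub>P1\<^esub> (\<ominus>\<^bsub>P1\<^esub> D f (L \<eta>) \<oplus>\<^bsub>P1\<^esub> \<ominus>\<^bsub>P1\<^esub> br1 (\<theta> f) \<eta>)"
      using f \<eta> by (simp add: a_minus_def P1.minus_add P1.a_comm)
    also have "\<dots> = br1 (\<theta>' f) \<eta>"
      using f \<eta> by (simp add: P1.r_neg2 \<theta>'_def lie.br_minus_left)
    finally show "D f (L \<eta>) \<ominus>\<^bsub>P1\<^esub> L (D f \<eta>) = br1 (\<theta>' f) \<eta>" .
  qed
  moreover have "L (K f g) = \<ominus>\<^bsub>P1\<^esub> d_contravariant R P0 br0 P1 \<D> \<theta>' f g"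
    if f: "f \<in> carrier P0" and g: "g \<in> carrier P0" for f g
  proof -
    \<comment> \<open>The second components of the bracket rule on two base elements; the left side
      uses \<open>split\<close> because their bracket has both a base and a fibre part.\<close>
    have "\<theta> (br0 f g) \<oplus>\<^bsub>P1\<^esub> L (K f g) = \<ominus>\<^bsub>P1\<^esub> D g (\<theta> f) \<oplus>\<^bsub>P1\<^esub> D f (\<theta> g)"
      using Poiss_br[OF XP, of "(f, \<zero>\<^bsub>P1\<^esub>)" "(g, \<zero>\<^bsub>P1\<^esub>)"] f g
      by (simp add: split[of "br0 f g" "K f g"] \<theta> br_base_base br_base_fibre br_fibre_base)
    then have "L (K f g) = \<ominus>\<^bsub>P1\<^esub> \<theta> (br0 f g) \<oplus>\<^bsub>P1\<^esub> (\<ominus>\<^bsub>P1\<^esub> D g (\<theta> f) \<oplus>\<^bsub>P1\<^esub> D f (\<theta> g))"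
      using f g P1.r_neg1[of "\<theta> (br0 f g)" "L (K f g)"] by simp
    also have "\<dots> = \<ominus>\<^bsub>P1\<^esub> d_contravariant R P0 br0 P1 \<D> \<theta>' f g"
      using f g by (simp add: d_contravariant_def a_minus_def \<theta>'_def D_minus P1.minus_add P1.a_ac)
    finally show ?thesis .
  qed
  ultimately show ?thesis unfolding M_zero_def L_def[symmetric] by blast
qed

text \<open>The converse construction: \<open>L\<close> and a witness \<open>\<theta>\<close> define
  a vertical map by sending \<open>(f, \<eta>)\<close> to the fibre element \<open>L \<eta>\<close>
  minus \<open>\<theta> f\<close>. The conditions in \<open>M_zero\<close> and \<open>Der\<close>
  are what its derivation rules require.\<close>

lemma M_zero_subset_vpart:
  assumes "L \<in> M_zero R P0 br0 P1 br1 \<D> \<K>"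
  shows "L \<in> vpart ` vertical"
proof -
  obtain \<theta> where lin: "L \<in> linear_maps P0 P1 P1"
    and Lbr: "\<And>\<eta> \<xi>. \<lbrakk>\<eta> \<in> carrier P1; \<xi> \<in> carrier P1\<rbrakk> \<Longrightarrow> L (br1 \<eta> \<xi>) = br1 (L \<eta>) \<xi> \<oplus>\<^bsub>P1\<^esub> br1 \<eta> (L \<xi>)"
    and \<theta>: "\<theta> \<in> Der R P0 P1"
    and comm: "\<And>f. f \<in> carrier P0 \<Longrightarrow> commutator P1 (D f) L = ad P1 br1 (\<theta> f)"
    and LK: "\<And>f g. \<lbrakk>f \<in> carrier P0; g \<in> carrier P0\<rbrakk> \<Longrightarrow>
      L (K f g) = \<ominus>\<^bsub>P1\<^esub> d_contravariant R P0 br0 P1 \<D> \<theta> f g"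
    \<comment> \<open>The commutator condition stands under quantifiers over both \<open>f\<close>
      and \<open>g\<close>; the zero of \<open>P0\<close> supplies a value for
      \<open>g\<close>.\<close>
    using assms P0.M.zero_closed unfolding M_zero_def by blast
  have \<theta>lin: "\<theta> \<in> linear_maps R P0 (restrict_scalars R P0 P1)"
    and \<theta>mult: "\<And>f g. \<lbrakk>f \<in> carrier P0; g \<in> carrier P0\<rbrakk> \<Longrightarrow>
      \<theta> (f \<otimes>\<^bsub>P0\<^esub> g) = f \<odot>\<^bsub>P1\<^esub> \<theta> g \<oplus>\<^bsub>P1\<^esub> g \<odot>\<^bsub>P1\<^esub> \<theta> f"
    using \<theta> unfolding Der_def by auto
  have L_cl [simp]: "L \<eta> \<in> carrier P1" if "\<eta> \<in> carrier P1" for \<eta>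
    using linear_maps_closed[OF lin that] .
  have \<theta>_cl [simp]: "\<theta> f \<in> carrier P1" if "f \<in> carrier P0" for f
    using linear_maps_closed[OF \<theta>lin that] by simp
  have L_zero: "L \<zero>\<^bsub>P1\<^esub> = \<zero>\<^bsub>P1\<^esub>"
    using P1.linear_maps_zero[OF lin P1.module_axioms] .
  have \<theta>_zero: "\<theta> \<zero>\<^bsub>P0\<^esub> = \<zero>\<^bsub>P1\<^esub>"
    using P0.linear_maps_zero[OF \<theta>lin module_P1] by simp
  have L_minus: "L (\<ominus>\<^bsub>P1\<^esub> \<eta>) = \<ominus>\<^bsub>P1\<^esub> L \<eta>" if "\<eta> \<in> carrier P1" for \<eta>
    using linear_maps_add[OF lin, of "\<ominus>\<^bsub>P1\<^esub> \<eta>" \<eta>] that L_zero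
    by (intro P1.minus_equality[symmetric]) (simp_all add: P1.l_neg)
  have LD: "L (D f \<eta>) = D f (L \<eta>) \<oplus>\<^bsub>P1\<^esub> \<ominus>\<^bsub>P1\<^esub> br1 (\<theta> f) \<eta>"
    if f: "f \<in> carrier P0" and \<eta>: "\<eta> \<in> carrier P1" for f \<eta>
  proof -
    have "D f (L \<eta>) \<oplus>\<^bsub>P1\<^esub> \<ominus>\<^bsub>P1\<^esub> L (D f \<eta>) = br1 (\<theta> f) \<eta>"
      using fun_cong[OF comm[OF f], of \<eta>] \<eta> by (simp add: commutator_def ad_def a_minus_def)
    then have "\<ominus>\<^bsub>P1\<^esub> br1 (\<theta> f) \<eta> = \<ominus>\<^bsub>P1\<^esub> D f (L \<eta>) \<oplus>\<^bsub>P1\<^esub> L (D f \<eta>)"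
      \<comment> \<open>The equation is applied from right to left:
        \<open>br1 (\<theta> f) \<eta>\<close> becomes a difference whose negative can be
        expanded.\<close>
      using f \<eta> by (simp add: P1.minus_add flip: \<open>D f (L \<eta>) \<oplus>\<^bsub>P1\<^esub> \<ominus>\<^bsub>P1\<^esub> L (D f \<eta>) = br1 (\<theta> f) \<eta>\<close>)
    then show ?thesis using f \<eta> by (simp add: P1.r_neg2)
  qed
  have LK': "L (K f g) \<oplus>\<^bsub>P1\<^esub> \<ominus>\<^bsub>P1\<^esub> \<theta> (br0 f g) = \<ominus>\<^bsub>P1\<^esub> D f (\<theta> g) \<oplus>\<^bsub>P1\<^esub> D g (\<theta> f)"
    if f: "f \<in> carrier P0" and g: "g \<in> carrier P0" for f g
    using f g by (simp add: LK d_contravariant_def a_minus_def P1.minus_add P1.a_assoc P1.r_neg)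
  define X where "X = (\<lambda>(f, \<eta>) \<in> carrier S. (\<zero>\<^bsub>P0\<^esub>, L \<eta> \<oplus>\<^bsub>P1\<^esub> \<ominus>\<^bsub>P1\<^esub> \<theta> f))"
  have X: "X (f, \<eta>) = (\<zero>\<^bsub>P0\<^esub>, L \<eta> \<oplus>\<^bsub>P1\<^esub> \<ominus>\<^bsub>P1\<^esub> \<theta> f)" if "f \<in> carrier P0" "\<eta> \<in> carrier P1" for f \<eta>
    using that by (simp add: X_def)
  have "X \<in> Poiss R S br"
  proof (rule PoissI, rule linear_mapsI)
    show "X a = undefined" if "a \<notin> carrier S" for a using that by (simp only: X_def restrict_apply if_False)
    fix a assume "a \<in> carrier S"
    then obtain f \<eta> where a: "a = (f, \<eta>)" "f \<in> carrier P0" "\<eta> \<in> carrier P1" by auto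
    show "X a \<in> carrier S" using a by (simp add: X)
    show "X (r \<odot>\<^bsub>S\<^esub> a) = r \<odot>\<^bsub>S\<^esub> X a" if "r \<in> carrier R" for r
      using a that by (simp add: X linear_maps_smult[OF lin] linear_maps_smult[OF \<theta>lin]
          P1.smult_r_distr P1.smult_r_minus)
    fix b assume "b \<in> carrier S"
    then obtain g \<xi> where b: "b = (g, \<xi>)" "g \<in> carrier P0" "\<xi> \<in> carrier P1" by auto
    show "X (a \<oplus>\<^bsub>S\<^esub> b) = X a \<oplus>\<^bsub>S\<^esub> X b"
      using a b by (simp add: X linear_maps_add[OF lin] linear_maps_add[OF \<theta>lin] P1.minus_add P1.a_ac)
    show "X (a \<otimes>\<^bsub>S\<^esub> b) = a \<otimes>\<^bsub>S\<^esub> X b \<oplus>\<^bsub>S\<^esub> b \<otimes>\<^bsub>S\<^esub> X a"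
      using a b by (simp add: X linear_maps_add[OF lin] linear_maps_smult[OF lin] \<theta>mult
          P1.smult_r_distr P1.smult_r_minus P1.minus_add P1.a_ac)
    \<comment> \<open>The last two terms are grouped so that \<open>LK'\<close> replaces them by an
      expression in \<open>D\<close> and \<open>\<theta>\<close> alone, which removes
      \<open>K\<close> and \<open>br0\<close>.\<close>
    have "X (br a b) = (\<zero>\<^bsub>P0\<^esub>, L (D f \<xi>) \<oplus>\<^bsub>P1\<^esub> \<ominus>\<^bsub>P1\<^esub> L (D g \<eta>) \<oplus>\<^bsub>P1\<^esub> L (br1 \<eta> \<xi>)
        \<oplus>\<^bsub>P1\<^esub> (L (K f g) \<oplus>\<^bsub>P1\<^esub> \<ominus>\<^bsub>P1\<^esub> \<theta> (br0 f g)))"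
      using a b by (simp add: bracket_eq X linear_maps_add[OF lin] L_minus a_minus_def P1.a_assoc)
    also have "L (K f g) \<oplus>\<^bsub>P1\<^esub> \<ominus>\<^bsub>P1\<^esub> \<theta> (br0 f g) = \<ominus>\<^bsub>P1\<^esub> D f (\<theta> g) \<oplus>\<^bsub>P1\<^esub> D g (\<theta> f)"
      using a b by (intro LK')
    also have "(\<zero>\<^bsub>P0\<^esub>, L (D f \<xi>) \<oplus>\<^bsub>P1\<^esub> \<ominus>\<^bsub>P1\<^esub> L (D g \<eta>) \<oplus>\<^bsub>P1\<^esub> L (br1 \<eta> \<xi>)
        \<oplus>\<^bsub>P1\<^esub> (\<ominus>\<^bsub>P1\<^esub> D f (\<theta> g) \<oplus>\<^bsub>P1\<^esub> D g (\<theta> f))) = br (X a) b \<oplus>\<^bsub>S\<^esub> br a (X b)"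
      using a b
      \<comment> \<open>\<open>LD\<close> moves \<open>L\<close> inside \<open>D\<close> at the cost
        of brackets with \<open>\<theta> f\<close> and \<open>\<theta> g\<close>. The second of
        these matches the bracket of \<open>\<eta>\<close> with minus \<open>\<theta> g\<close> on
        the right only after \<open>br_skew\<close>.\<close>
      by (simp add: LD Lbr X bracket_eq a_minus_def D_add D_minus lie.br_add_left
          lie.br_add_right lie.br_minus_left lie.br_minus_right P1.minus_add P1.a_ac
          lie.br_skew[of "\<theta> g" \<eta>])
    finally show "X (br a b) = br (X a) b \<oplus>\<^bsub>S\<^esub> br a (X b)" .
  qed
  then have "X \<in> vertical" unfolding vertical_def by (auto simp: X)
  \<comment> \<open>On the fibre the correction term is \<open>\<theta> 0\<close>, which is
    zero.\<close>
  moreover have "vpart X = L"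
  proof
    fix \<eta>
    show "vpart X \<eta> = L \<eta>"
      using linear_maps_undefined[OF lin] by (simp add: vpart_def X \<theta>_zero)
  qed
  ultimately show ?thesis by blast
qed

text \<open>\<open>isomorphic_quotI\<close> with \<open>Poiss\<close> as \<open>S\<close>,
  \<open>Ham\<close> as \<open>H\<close>, \<open>vertical\<close> as \<open>N\<close> and
  \<open>vpart\<close> as \<open>\<Psi>\<close>. The two inclusions for \<open>M_zero\<close>
  identify the numerator, and \<open>vpart_vertical_Ham\<close> identifies the denominator.\<close>

lemma poisson_H1_isomorphic:
  assumes perfect: "perfect_lie P0 P1 br1" and centerless: "centerless_lie P1 br1"
    and H1: "carrier (poisson_H1 R P0 br0) = {\<zero>\<^bsub>poisson_H1 R P0 br0\<^esub>}"
  shows "isomorphic_modules R (poisson_H1 R S br)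
    (quot_module
      ((map_module (restrict_scalars R P0 P1))\<lparr>carrier := M_zero R P0 br0 P1 br1 \<D> \<K>\<rparr>)
      (C_zero R P0 br0 P1 \<D> <+>\<^bsub>map_module (restrict_scalars R P0 P1)\<^esub> Inn P1 br1))"
proof -
  interpret A: module R "map_module S" by (rule module_map_module[OF P.module])
  have "M_zero R P0 br0 P1 br1 \<D> \<K> = vpart ` vertical"
    using vpart_mem_M_zero M_zero_subset_vpart by blast
  moreover have "isomorphic_modules R (quot_module ((map_module S)\<lparr>carrier := Poiss R S br\<rparr>) (Ham S br))
    (quot_module ((map_module (restrict_scalars R P0 P1))\<lparr>carrier := vpart ` vertical\<rparr>)
      (vpart ` (vertical \<inter> Ham S br)))"
  proof (rule isomorphic_quotI)
    show "module R (map_module S)" by (rule A.module_axioms)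
    show "module R (map_module (restrict_scalars R P0 P1))" by (rule module_map_module[OF module_P1])
    show "\<exists>Z \<in> Ham S br. \<exists>Y \<in> vertical. X = Z \<oplus>\<^bsub>map_module S\<^esub> Y" if "X \<in> Poiss R S br" for X
      using Poiss_decomp[OF that perfect P0.Poiss_subset_Ham[OF H1]] .
    show "X \<in> Ham S br" if X: "X \<in> vertical"
      and eq: "vpart X = \<zero>\<^bsub>map_module (restrict_scalars R P0 P1)\<^esub>" for X
    \<comment> \<open>A vertical \<open>X\<close> with zero restriction is itself zero, and
      \<open>Ham S br\<close> contains zero.\<close>
    proof -
      have "vpart X \<eta> = \<zero>\<^bsub>P1\<^esub>" if "\<eta> \<in> carrier P1" for \<eta> using that by (simp add: eq)
      then show ?thesis
        using vertical_vpart_zero[OF centerless X] A.submodule_abelian_subgroup[OF P.submodule_Ham]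
        by (metis abelian_subgroup.axioms(1) additive_subgroup.zero_closed)
    qed
    show "vpart X \<in> carrier (map_module (restrict_scalars R P0 P1))" if "X \<in> carrier (map_module S)" for X
      using that by (rule vpart_closed)
    show "vertical \<subseteq> Poiss R S br" unfolding vertical_def by blast
  qed (rule vpart_add vpart_smult P.submodule_Poiss P.submodule_Ham submodule_vertical
      P.Ham_subset_Poiss)+
  ultimately show ?thesis unfolding poisson_H1_def vpart_vertical_Ham by simp
qed

end

theorem theorem8p13:
  fixes R :: "('r, 'm) ring_scheme"
    and P0 :: "('r, 'a, 'n) module_scheme"
    and br0 :: "'a \<Rightarrow> 'a \<Rightarrow> 'a"
    and P1 :: "('a, 'b, 'k) module_scheme"
    and br :: "'a \<times> 'b \<Rightarrow> 'a \<times> 'b \<Rightarrow> 'a \<times> 'b"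
    and br1 :: "'b \<Rightarrow> 'b \<Rightarrow> 'b"
    and \<D> :: "('a \<Rightarrow> 'a) set \<Rightarrow> 'b \<Rightarrow> 'b"
    and \<K> :: "('a \<Rightarrow> 'a) set \<Rightarrow> ('a \<Rightarrow> 'a) set \<Rightarrow> 'b"
  assumes "admissible_poisson_algebra R P0 br0 P1 br"
    and "poisson_triple R P0 br0 P1 br br1 \<D> \<K>"
    and "perfect_lie P0 P1 br1"
    and "centerless_lie P1 br1"
    and "carrier (poisson_H1 R P0 br0) = {\<zero>\<^bsub>poisson_H1 R P0 br0\<^esub>}"
  shows "isomorphic_modules R
    (poisson_H1 R (semidirect R P0 P1) br)
    (quot_module
      ((map_module (restrict_scalars R P0 P1))\<lparr>carrier := M_zero R P0 br0 P1 br1 \<D> \<K>\<rparr>)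
      (C_zero R P0 br0 P1 \<D> <+>\<^bsub>map_module (restrict_scalars R P0 P1)\<^esub> Inn P1 br1))"
proof -
  interpret poisson_triple R P0 br0 P1 br br1 \<D> \<K> by (rule assms(2))
  show ?thesis using assms(3-5) by (rule poisson_H1_isomorphic)
qed

end
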